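(* Consider any instance of the online allocation model with full compatibility in which each bonus function $f_i$ is nonnegative, nondecreasing, and discrete concave on $\{0,1,\dots,b_i\}$. For $\alpha>1$ and $\theta\in[1,1+\alpha]$ define $$H_\alpha(\theta)=(\theta-1)^2\min\left\{\frac1{\alpha^2},\frac1{\theta^2}\right\}+\frac{\alpha^2-(\theta-1)^2}{(1+\alpha)^2\theta^2},\qquad c_{\det}(\alpha)=\min_{\theta\in[1,1+\alpha]}H_\alpha(\theta).$$ Then for every $\alpha>1$ (such that $\alpha S$ and $(1+\alpha)S$ are integers at every phase start, e.g. $\alpha$ an integer), the Intermediate Target Repair algorithm $\pi$ with multiplier $\alpha$ satisfies, for every realized arrival count $\ell$, $$\mathrm{Rev}^\pi(\ell)\ \ge\ c_{\det}(\alpha)\,U(\ell).$$ For $\alpha=2$ this gives $c_{\det}(2)=0.2466\ldots$. Optimizing over $\alpha$ gives $\sup_{\alpha>1}c_{\det}(\alpha)=0.2467\ldots$, at $\alpha\approx 1.9232$. Consequently, the algorithm (with $\alpha=2$) achieves $$\mathbb E[\mathrm{Rev}^\pi(L)]\ \ge\ 0.2466\,\mathbb E[U(L)]\ \ge\ 0.2466\,\mathrm{OPT}_{\mathrm{on}}.$$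
   Context: Model. An instance consists of products $\mathcal I=\{1,\dots,m\}$, capacities $b_i\in\mathbb Z_+$, base rewards $r_i\ge 0$, bonus functions $f_i:\mathbb Z_+\to\mathbb R_+$, nonnegative and nondecreasing with $f_i(0)=0$, a horizon of $T$ periods and arrival probabilities $p_1,\dots,p_T\in[0,1]$. In period $t$ a customer arrives with probability $p_t$, independently across periods; $L$ is the total number of arrivals. Each arriving customer must be immediately and irrevocably assigned to a product with remaining capacity or rejected; every customer may be assigned to every product (full compatibility). The $k$-th sale of product $i$ yields reward $r_i+f_i(k)$; $R_i(n)=n r_i+\sum_{k=1}^n f_i(k)$, $R_i(0)=0$, and $V(\boldsymbol x)=\sum_{i}R_i(x_i)$. An online algorithm knows the instance parameters, but its decisions depend only on arrivals observed so far, its past decisions and independent internal randomization; $\mathrm{OPT}_{\mathrm{on}}=\sup_\pi\mathbb E[\mathrm{Rev}^\pi]$ over all online algorithms. $C=\sum_i b_i$. Offline benchmark: $U(\ell)=\max\{V(\boldsymbol x): \boldsymbol x\in\mathbb Z_+^m,\ x_i\le b_i\ \forall i,\ \sum_i x_i\le \ell\}$. Discrete concavity of $f_i$ on $\{0,\dots,b_i\}$: $f_i(k+1)-f_i(k)\le f_i(k)-f_i(k-1)$ for $k=1,\dots,b_i-1$. Repair orders. For a feasible allocation $\boldsymbol s$ and $\boldsymbol d\in\mathbb Z_+^m$ with $d_i\le b_i-s_i$ and $D=\|\boldsymbol d\|_1$, a repair order is a sequence $\eta=(\eta_1,\dots,\eta_D)$ of products containing exactly $d_i$ copies of each $i$;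 its prefix increment is $d^{(h)}_i=|\{\tau\le h:\eta_\tau=i\}|$. Call $\eta$ prefix-robust if $V(\boldsymbol s+\boldsymbol d^{(h)})-V(\boldsymbol s)\ge (h/D)^2\,(V(\boldsymbol s+\boldsymbol d)-V(\boldsymbol s))$ for all $h=0,\dots,D$ (if $D=0$ the order is empty). Under the discrete concavity assumption a prefix-robust order always exists. Intermediate Target Repair with multiplier $\alpha>1$. Start with $\boldsymbol s=\boldsymbol 0$. Assign the first arrival to some $i^\star\in\arg\max_{i:b_i>0}R_i(1)$ and set $s_{i^\star}=1$. While $\|\boldsymbol s\|_1<C$, run a phase: set $S=\|\boldsymbol s\|_1$, $M=\min\{(1+\alpha)S,C\}$, $K=\min\{\alpha S,C\}$; compute $\boldsymbol x^K\in\arg\max\{V(\boldsymbol x):0\le x_i\le b_i,\ \boldsymbol x\in\mathbb Z_+^m,\ \|\boldsymbol x\|_1=K\}$; set $d_i=(x^K_i-s_i)^+$, $D=\|\boldsymbol d\|_1$, and choose a prefix-robust repair order $\eta$ for $\boldsymbol d$ from $\boldsymbol s$. Until $\|\boldsymbol s\|_1=M$, assign the $h$-th arrival of the phase to $\eta_h$ if $h\le D$, and otherwise to any product with remaining capacity, updating $\boldsymbol s$ after each assignment. The algorithm stops when arrivals stop; once all products are full, further customers are rejected. The algorithm is in normalized integral form: $\alpha S$ and $(1+\alpha)S$ are integers at every phase start (automatic for integer $\alpha$). $\mathrm{Rev}^\pi(\ell)$ denotes its total reward when exactly $\ell$ customers arrive. *)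

theory Defs
  imports "HOL-Probability.Probability"
begin

section \<open>Instances and allocations\<close>

record alloc_instance =
  num_products :: nat
  capacity :: "nat \<Rightarrow> nat"
  base_reward :: "nat \<Rightarrow> real"
  bonus :: "nat \<Rightarrow> nat \<Rightarrow> real"
  horizon :: nat
  arrival_prob :: "nat \<Rightarrow> real"

definition products :: "alloc_instance \<Rightarrow> nat set" where
  "products I = {1..num_products I}"

definition total_capacity :: "alloc_instance \<Rightarrow> nat" where
  "total_capacity I = (\<Sum>i\<in>products I. capacity I i)"

definition valid_instance :: "alloc_instance \<Rightarrow> bool" where
  "valid_instance I \<longleftrightarrow>
     (\<forall>i\<in>products I. base_reward I i \<ge> 0 \<and> (\<forall>k. bonus I i k \<ge> 0) \<and>
        mono (bonus I i) \<and> bonus I i 0 = 0) \<and>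
     (\<forall>t\<in>{1..horizon I}. 0 \<le> arrival_prob I t \<and> arrival_prob I t \<le> 1)"

definition concave_bonuses :: "alloc_instance \<Rightarrow> bool" where
  "concave_bonuses I \<longleftrightarrow>
     (\<forall>i\<in>products I. \<forall>k. 1 \<le> k \<and> k < capacity I i \<longrightarrow>
        bonus I i (k + 1) - bonus I i k \<le> bonus I i k - bonus I i (k - 1))"

definition product_reward :: "alloc_instance \<Rightarrow> nat \<Rightarrow> nat \<Rightarrow> real" where
  "product_reward I i n = real n * base_reward I i + (\<Sum>k=1..n. bonus I i k)"

definition alloc_value :: "alloc_instance \<Rightarrow> (nat \<Rightarrow> nat) \<Rightarrow> real" where
  "alloc_value I x = (\<Sum>i\<in>products I. product_reward I i (x i))"

definition alloc_size :: "alloc_instance \<Rightarrow> (nat \<Rightarrow> nat) \<Rightarrow> nat" where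
  "alloc_size I x = (\<Sum>i\<in>products I. x i)"

text \<open>Vectors indexed by the products are functions that vanish at all other indices.\<close>

definition feasible :: "alloc_instance \<Rightarrow> (nat \<Rightarrow> nat) \<Rightarrow> bool" where
  "feasible I x \<longleftrightarrow> (\<forall>i\<in>products I. x i \<le> capacity I i) \<and> (\<forall>i. i \<notin> products I \<longrightarrow> x i = 0)"

definition offline_opt :: "alloc_instance \<Rightarrow> nat \<Rightarrow> real" where
  "offline_opt I l = Max (alloc_value I ` {x. feasible I x \<and> alloc_size I x \<le> l})"


section \<open>Rewards of decision sequences\<close>

text \<open>A decision is \<open>Some i\<close> for a sale of product \<open>i\<close>, and \<open>None\<close> for no sale
  (a rejection, or a period without arrival).\<close>

definition total_reward :: "alloc_instance \<Rightarrow> nat option list \<Rightarrow> real" where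
  "total_reward I ds = (\<Sum>j<length ds. case ds ! j of
       None \<Rightarrow> 0
     | Some i \<Rightarrow> base_reward I i + bonus I i (count_list (take (Suc j) ds) (Some i)))"


section \<open>Arrivals and online algorithms\<close>

definition arrivals :: "alloc_instance \<Rightarrow> (nat \<Rightarrow> bool) pmf" where
  "arrivals I = Pi_pmf {1..horizon I} False (\<lambda>t. bernoulli_pmf (arrival_prob I t))"

definition num_arrivals :: "alloc_instance \<Rightarrow> (nat \<Rightarrow> bool) \<Rightarrow> nat" where
  "num_arrivals I a = card {t\<in>{1..horizon I}. a t}"

text \<open>An online algorithm is a seed distribution \<open>M\<close> together with a map \<open>g\<close> that takes the
  seed, the arrival indicators up to and including the current period, and the decisions of all
  earlier periods. Seeds are real numbers without loss of generality, since only finitely many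
  histories and decisions occur.\<close>

definition online_algorithm ::
  "alloc_instance \<Rightarrow> real measure \<Rightarrow> (real \<Rightarrow> bool list \<Rightarrow> nat option list \<Rightarrow> nat option) \<Rightarrow> bool" where
  "online_algorithm I M g \<longleftrightarrow> prob_space M \<and>
     (\<forall>as ds. (\<lambda>w. g w as ds) \<in> measurable M (count_space UNIV)) \<and>
     (\<forall>w\<in>space M. \<forall>as ds i. g w as ds = Some i \<longrightarrow>
        i \<in> products I \<and> count_list ds (Some i) < capacity I i)"

fun decisions ::
  "(bool list \<Rightarrow> nat option list \<Rightarrow> nat option) \<Rightarrow> (nat \<Rightarrow> bool) \<Rightarrow> nat \<Rightarrow> nat option list" where
  "decisions g a 0 = []"
| "decisions g a (Suc t) =
     decisions g a t @ [if a (Suc t) then g (map a [1..<Suc (Suc t)]) (decisions g a t) else None]"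

definition online_value ::
  "alloc_instance \<Rightarrow> real measure \<Rightarrow> (real \<Rightarrow> bool list \<Rightarrow> nat option list \<Rightarrow> nat option) \<Rightarrow> real" where
  "online_value I M g =
     (\<integral>(w, a). total_reward I (decisions (g w) a (horizon I)) \<partial>(M \<Otimes>\<^sub>M measure_pmf (arrivals I)))"

definition opt_online :: "alloc_instance \<Rightarrow> real" where
  "opt_online I = (SUP (M, g)\<in>{(M, g). online_algorithm I M g}. online_value I M g)"


section \<open>Intermediate Target Repair\<close>

definition repair_order :: "(nat \<Rightarrow> nat) \<Rightarrow> nat list \<Rightarrow> bool" where
  "repair_order d \<eta> \<longleftrightarrow> (\<forall>i. count_list \<eta> i = d i)"

definition prefix_robust :: "alloc_instance \<Rightarrow> (nat \<Rightarrow> nat) \<Rightarrow> (nat \<Rightarrow> nat) \<Rightarrow> nat list \<Rightarrow> bool" where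
  "prefix_robust I s d \<eta> \<longleftrightarrow> repair_order d \<eta> \<and>
     (\<forall>h\<le>length \<eta>.
        alloc_value I (\<lambda>i. s i + count_list (take h \<eta>) i) - alloc_value I s
          \<ge> (real h / real (length \<eta>))\<^sup>2 * (alloc_value I (\<lambda>i. s i + d i) - alloc_value I s))"

text \<open>The state of the algorithm is the list \<open>\<sigma>\<close> of products assigned so far, so that
  \<open>count_list \<sigma>\<close> is the current allocation; \<open>\<tau>\<close> is the list of assignments
  made in the phase that starts from \<open>\<sigma>\<close>. The truncated subtraction of naturals gives the
  positive part.\<close>

definition itr_phase :: "alloc_instance \<Rightarrow> real \<Rightarrow> nat list \<Rightarrow> nat list \<Rightarrow> bool" where
  "itr_phase I \<alpha> \<sigma> \<tau> \<longleftrightarrow>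
     (let C = total_capacity I; S = length \<sigma>; s = count_list \<sigma>;
          M = nat \<lfloor>min ((1 + \<alpha>) * real S) (real C)\<rfloor>;
          K = nat \<lfloor>min (\<alpha> * real S) (real C)\<rfloor>
      in \<exists>x \<eta>. is_arg_max (alloc_value I) (\<lambda>y. feasible I y \<and> alloc_size I y = K) x \<and>
           prefix_robust I s (\<lambda>i. x i - s i) \<eta> \<and>
           length \<tau> = M - S \<and>
           (\<forall>h<length \<tau>.
              if h < length \<eta> then \<tau> ! h = \<eta> ! h
              else \<tau> ! h \<in> products I \<and>
                   count_list (\<sigma> @ take h \<tau>) (\<tau> ! h) < capacity I (\<tau> ! h)))"

text \<open>Assignment lists at the ends of the first step and of the phases, for arbitrary resolution
  of the choices that the algorithm leaves open.\<close>

inductive itr_state :: "alloc_instance \<Rightarrow> real \<Rightarrow> nat list \<Rightarrow> bool" for I \<alpha> where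
  first: "is_arg_max (\<lambda>i. product_reward I i 1) (\<lambda>i. i \<in> products I \<and> capacity I i > 0) i
            \<Longrightarrow> itr_state I \<alpha> [i]"
| phase: "itr_state I \<alpha> \<sigma> \<Longrightarrow> length \<sigma> < total_capacity I \<Longrightarrow> itr_phase I \<alpha> \<sigma> \<tau>
            \<Longrightarrow> itr_state I \<alpha> (\<sigma> @ \<tau>)"

text \<open>Normalized integral form; under it the floors in \<open>itr_phase\<close> are exact.\<close>

definition integral_phases :: "alloc_instance \<Rightarrow> real \<Rightarrow> bool" where
  "integral_phases I \<alpha> \<longleftrightarrow>
     (\<forall>\<sigma>. itr_state I \<alpha> \<sigma> \<and> length \<sigma> < total_capacity I \<longrightarrow>
        \<alpha> * real (length \<sigma>) \<in> \<int> \<and> (1 + \<alpha>) * real (length \<sigma>) \<in> \<int>)"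

text \<open>A complete execution: the assignments made if arrivals continue until all products are full.
  Since no decision depends on future arrivals, \<open>l\<close> arrivals realize its first \<open>l\<close> entries.\<close>

definition itr_execution :: "alloc_instance \<Rightarrow> real \<Rightarrow> nat list \<Rightarrow> bool" where
  "itr_execution I \<alpha> \<sigma> \<longleftrightarrow>
     (if total_capacity I = 0 then \<sigma> = []
      else itr_state I \<alpha> \<sigma> \<and> length \<sigma> = total_capacity I)"

definition itr_reward :: "alloc_instance \<Rightarrow> nat list \<Rightarrow> nat \<Rightarrow> real" where
  "itr_reward I \<sigma> l =
     total_reward I (map Some (take l \<sigma>) @ replicate (l - length \<sigma>) None)"


section \<open>The guarantee\<close>

definition H_det :: "real \<Rightarrow> real \<Rightarrow> real" where
  "H_det \<alpha> \<theta> = (\<theta> - 1)\<^sup>2 * min (1 / \<alpha>\<^sup>2) (1 / \<theta>\<^sup>2)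
               + (\<alpha>\<^sup>2 - (\<theta> - 1)\<^sup>2) / ((1 + \<alpha>)\<^sup>2 * \<theta>\<^sup>2)"

definition c_det :: "real \<Rightarrow> real" where
  "c_det \<alpha> = (INF \<theta>\<in>{1..1 + \<alpha>}. H_det \<alpha> \<theta>)"

lemma c_det_is_minimum:
  assumes "\<alpha> > 1"
  shows "\<exists>\<theta>\<in>{1..1 + \<alpha>}. c_det \<alpha> = H_det \<alpha> \<theta> \<and> (\<forall>\<theta>'\<in>{1..1 + \<alpha>}. H_det \<alpha> \<theta> \<le> H_det \<alpha> \<theta>')"
proof -
  have "continuous_on {1..1 + \<alpha>} (H_det \<alpha>)"
    unfolding H_det_def using assms by (intro continuous_intros) auto
  then obtain \<theta> where \<theta>: "\<theta> \<in> {1..1 + \<alpha>}" "\<forall>\<theta>'\<in>{1..1 + \<alpha>}. H_det \<alpha> \<theta> \<le> H_det \<alpha> \<theta>'"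
    using continuous_attains_inf[of "{1..1 + \<alpha>}" "H_det \<alpha>"] assms by auto
  have "c_det \<alpha> = H_det \<alpha> \<theta>"
    unfolding c_det_def by (rule cInf_eq_minimum) (use \<theta> in auto)
  with \<theta> show ?thesis by blast
qed

end

(*
  Since a bonus function is concave and vanishes at 0, the k-th marginal reward divided by k is
  nonincreasing in k. Hence some unit of an allocation of size n is worth at most 2 / (n + 1) of its
  value, and removing cheapest units one after the other gives U(k) >= (k/l)^2 U(l) for k <= l.
  During a phase that starts with S sales, the value after h = l - S further sales is at least a
  convex combination, with weight (h / (alpha S))^2 on the target, of the value at the start of the
  phase and the target value U(alpha S). The target of the previous phase bounds the former from
  below, quadratic scaling the latter, and together they give H(l/S) U(l).
*)
theory Submission
  imports Defs
begin

section \<open>Quadratic scaling of the offline optimum\<close>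

text \<open>A repair takes at most \<alpha> S steps, so a phase of \<alpha> S sales completes it and
  ends with at least the value of the target of size \<alpha> S. The next phase starts from (1 +
  \<alpha>) S sales, and the ratio \<alpha> / (1 + \<alpha>) of these two sizes is the factor in the
  second summand of \<open>H_det\<close>. This lower bound is all that one phase hands to the next.
  It is kept for every later arrival count l, since l is unknown when a phase ends. The min in the
  first summand distinguishes counts below and above the target size. The position of the supremum
  over \<alpha> is certified by a single constant, 0.24675663087. It bounds \<open>c_det\<close>
  from below at one rational point and from above at every \<alpha> outside a window of width
  0.0001, so a maximizer over the window is a maximizer overall.\<close>

lemma product_reward_0 [simp]: "product_reward I i 0 = 0"
  by (simp add: product_reward_def)

lemma product_reward_Suc:
  "product_reward I i (Suc n) = product_reward I i n + (base_reward I i + bonus I i (Suc n))"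
  by (simp add: product_reward_def algebra_simps)

lemma finite_products [simp]: "finite (products I)"
  by (simp add: products_def)

lemma marginal_nonneg:
  assumes "valid_instance I" "i \<in> products I"
  shows "base_reward I i + bonus I i k \<ge> 0"
  using assms by (simp add: valid_instance_def)

lemma product_reward_mono:
  assumes "valid_instance I" "i \<in> products I" "m \<le> n"
  shows "product_reward I i m \<le> product_reward I i n"
  using \<open>m \<le> n\<close>
proof (induction n rule: dec_induct)
  case (step n)
  then show ?case using marginal_nonneg[OF assms(1,2), of "Suc n"] by (simp add: product_reward_Suc)
qed simp

lemma alloc_value_mono:
  assumes "valid_instance I" "\<And>i. i \<in> products I \<Longrightarrow> x i \<le> y i"
  shows "alloc_value I x \<le> alloc_value I y"
  unfolding alloc_value_def by (intro sum_mono product_reward_mono assms)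

lemma alloc_value_cong:
  "(\<And>i. i \<in> products I \<Longrightarrow> x i = y i) \<Longrightarrow> alloc_value I x = alloc_value I y"
  unfolding alloc_value_def by (intro sum.cong) auto

lemma alloc_value_0 [simp]: "alloc_value I (\<lambda>_. 0) = 0"
  by (simp add: alloc_value_def)

lemma alloc_value_nonneg:
  assumes "valid_instance I"
  shows "alloc_value I x \<ge> 0"
  using alloc_value_mono[OF assms, of "\<lambda>_. 0" x] by simp

lemma alloc_value_upd:
  assumes "i \<in> products I"
  shows "alloc_value I (x(i := n)) = alloc_value I x - product_reward I i (x i) + product_reward I i n"
proof -
  have "alloc_value I (x(i := n)) = product_reward I i n + (\<Sum>j\<in>products I - {i}. product_reward I j (x j))"
    unfolding alloc_value_def using assms by (subst sum.remove[of _ i]) (auto intro!: sum.cong)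
  moreover have "alloc_value I x = product_reward I i (x i) + (\<Sum>j\<in>products I - {i}. product_reward I j (x j))"
    unfolding alloc_value_def using assms by (subst sum.remove[of _ i]) auto
  ultimately show ?thesis by simp
qed

lemma alloc_size_upd:
  assumes "i \<in> products I"
  shows "alloc_size I (x(i := n)) + x i = alloc_size I x + n"
proof -
  have "alloc_size I (x(i := n)) = n + (\<Sum>j\<in>products I - {i}. x j)"
    unfolding alloc_size_def using assms by (subst sum.remove[of _ i]) (auto intro!: sum.cong)
  moreover have "alloc_size I x = x i + (\<Sum>j\<in>products I - {i}. x j)"
    unfolding alloc_size_def using assms by (subst sum.remove[of _ i]) auto
  ultimately show ?thesis by simp
qed

text \<open>Chords from the origin to a concave function vanishing at 0 have decreasing slope. The
  cross-multiplied form also covers k = 0 and so gives the induction its base.\<close>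

lemma bonus_ratio_antimono:
  assumes "valid_instance I" "concave_bonuses I" "i \<in> products I"
  shows "k < capacity I i \<Longrightarrow> real k * bonus I i (Suc k) \<le> real (Suc k) * bonus I i k"
proof (induction k)
  case 0
  then show ?case using assms by (simp add: valid_instance_def)
next
  case (Suc k)
  have "bonus I i (Suc (Suc k)) \<le> 2 * bonus I i (Suc k) - bonus I i k"
    using assms(2,3) Suc.prems unfolding concave_bonuses_def
    by (auto dest!: bspec[of _ _ i] spec[of _ "Suc k"])
  then have "real (Suc k) * bonus I i (Suc (Suc k)) \<le> real (Suc k) * (2 * bonus I i (Suc k) - bonus I i k)"
    by (intro mult_left_mono) auto
  also have "\<dots> \<le> real (Suc (Suc k)) * bonus I i (Suc k)"
    using Suc by (simp add: algebra_simps)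
  finally show ?case .
qed

text \<open>The k-th marginal is at least k / n times the n-th, and the numbers 1, ..., n sum to n
  (n + 1) / 2. Equality holds for marginals proportional to k; this case is the origin of the
  exponent 2 in the scaling.\<close>

lemma marginal_le_average:
  assumes "valid_instance I" "concave_bonuses I" "i \<in> products I"
  shows "n \<le> capacity I i \<Longrightarrow> 0 < n \<Longrightarrow>
    real (n + 1) * (base_reward I i + bonus I i n) \<le> 2 * product_reward I i n"
proof (induction n)
  case (Suc n)
  show ?case
  proof (cases "n = 0")
    case False
    have "base_reward I i \<ge> 0" using assms by (simp add: valid_instance_def)
    moreover have "real n * bonus I i (Suc n) \<le> real (Suc n) * bonus I i n"
      using bonus_ratio_antimono[OF assms, of n] Suc.prems by simp
    ultimately show ?thesis
      using Suc False by (simp add: product_reward_Suc algebra_simps)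
  qed (simp add: product_reward_Suc)
qed simp

text \<open>Averaging with weights \<open>y i + 1\<close> over the sold products. The weights sum to
  n + 1 plus the number of these products, hence to at least n + 2. If every last unit were worth
  more than 2 / (n + 2) of the value, the weighted sum would exceed the bound 2 V that
  \<open>marginal_le_average\<close> gives.\<close>

lemma exists_cheap_unit:
  assumes "valid_instance I" "concave_bonuses I" "feasible I y" and n: "alloc_size I y = Suc n"
  shows "\<exists>i\<in>products I. y i > 0 \<and> real (n + 2) * (base_reward I i + bonus I i (y i)) \<le> 2 * alloc_value I y"
proof (rule ccontr)
  let ?g = "\<lambda>i. base_reward I i + bonus I i (y i)" and ?P = "{i\<in>products I. y i > 0}"
  assume "\<not> ?thesis"
  then have *: "\<And>i. i \<in> ?P \<Longrightarrow> 2 * alloc_value I y < real (n + 2) * ?g i" by force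
  have sz: "(\<Sum>i\<in>?P. y i) = Suc n"
    using n unfolding alloc_size_def by (subst sum.mono_neutral_left[of "products I"]) auto
  then have ne: "?P \<noteq> {}" by (metis sum.empty nat.distinct(1))
  then have "card ?P > 0" by (simp add: card_gt_0_iff)
  then have sz': "real (n + 2) \<le> (\<Sum>i\<in>?P. real (y i + 1))"
    using sz by (simp add: sum.distrib flip: of_nat_sum)
  have "real (n + 2) * (2 * alloc_value I y) \<le> (\<Sum>i\<in>?P. real (y i + 1)) * (2 * alloc_value I y)"
    by (intro mult_right_mono sz') (simp add: alloc_value_nonneg assms)
  also have "\<dots> = (\<Sum>i\<in>?P. real (y i + 1) * (2 * alloc_value I y))"
    by (simp add: sum_distrib_right)
  also have "\<dots> < (\<Sum>i\<in>?P. real (y i + 1) * (real (n + 2) * ?g i))"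
    by (intro sum_strict_mono mult_strict_left_mono * ne) auto
  also have "\<dots> = real (n + 2) * (\<Sum>i\<in>?P. real (y i + 1) * ?g i)"
    by (simp add: sum_distrib_left algebra_simps)
  also have "\<dots> \<le> real (n + 2) * (\<Sum>i\<in>?P. 2 * product_reward I i (y i))"
    using assms by (intro mult_left_mono sum_mono marginal_le_average) (auto simp: feasible_def)
  also have "(\<Sum>i\<in>?P. 2 * product_reward I i (y i)) = 2 * alloc_value I y"
    unfolding alloc_value_def sum_distrib_left
    by (rule sum.mono_neutral_left) auto
  finally show False by simp
qed

lemma suballocation_step:
  assumes "valid_instance I" "concave_bonuses I" "feasible I y" and n: "alloc_size I y = Suc n"
  shows "\<exists>z. feasible I z \<and> alloc_size I z = n \<and>
    alloc_value I z \<ge> (real n / real (Suc n))\<^sup>2 * alloc_value I y"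
proof -
  obtain i where i: "i \<in> products I" "y i > 0"
      "real (n + 2) * (base_reward I i + bonus I i (y i)) \<le> 2 * alloc_value I y"
    using exists_cheap_unit[OF assms] by blast
  let ?z = "y(i := y i - 1)"
  have "alloc_size I ?z = n" using alloc_size_upd[OF i(1), of y "y i - 1"] n i(2) by simp
  moreover have "feasible I ?z" using assms(3) by (auto simp: feasible_def intro: le_trans[OF diff_le_self])
  moreover have "alloc_value I ?z \<ge> (real n / real (Suc n))\<^sup>2 * alloc_value I y"
  proof -
    obtain k where k: "y i = Suc k" using i(2) by (cases "y i") auto
    have "base_reward I i + bonus I i (y i) \<le> 2 * alloc_value I y / real (n + 2)"
      using i(3) by (simp add: field_simps)
    then have "alloc_value I ?z \<ge> (1 - 2 / real (n + 2)) * alloc_value I y"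
      using k by (simp add: alloc_value_upd[OF i(1)] product_reward_Suc algebra_simps)
    \<comment> \<open>Removing the cheap unit leaves the fraction n / (n + 2), which dominates the
      squared ratio because n (n + 2) is at most the square of n + 1.\<close>
    moreover have "(real n)\<^sup>2 * real (n + 2) \<le> real n * (real (Suc n))\<^sup>2"
      by (simp add: power2_eq_square algebra_simps)
    then have "1 - 2 / real (n + 2) \<ge> (real n / real (Suc n))\<^sup>2"
      unfolding power_divide by (simp add: divide_simps)
    then have "(real n / real (Suc n))\<^sup>2 * alloc_value I y \<le> (1 - 2 / real (n + 2)) * alloc_value I y"
      by (intro mult_right_mono alloc_value_nonneg assms)
    ultimately show ?thesis by linarith
  qed
  ultimately show ?thesis by blast
qed

lemma suballocation:
  assumes "valid_instance I" "concave_bonuses I" "feasible I y" "k \<le> alloc_size I y"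
  shows "\<exists>z. feasible I z \<and> alloc_size I z = k \<and>
    alloc_value I z \<ge> (real k / real (alloc_size I y))\<^sup>2 * alloc_value I y"
  using assms(3,4)
proof (induction "alloc_size I y" arbitrary: y)
  case 0
  then show ?case using alloc_value_nonneg[OF assms(1)] by auto
next
  case (Suc n)
  show ?case
  proof (cases "k = Suc n")
    case True
    then show ?thesis using Suc by (intro exI[of _ y]) auto
  next
    case False
    obtain z where z: "feasible I z" "alloc_size I z = n"
      "alloc_value I z \<ge> (real n / real (Suc n))\<^sup>2 * alloc_value I y"
      using suballocation_step[OF assms(1,2) Suc.prems(1)] Suc.hyps(2) by metis
    obtain w where w: "feasible I w" "alloc_size I w = k"
      "alloc_value I w \<ge> (real k / real n)\<^sup>2 * alloc_value I z"
      using Suc.hyps(1)[of z] z False Suc by auto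
    have "(real k / real (Suc n))\<^sup>2 * alloc_value I y \<le> alloc_value I w"
    \<comment> \<open>The one-step factors telescope only after division by n, which may be 0 when k
      = 0.\<close>
    proof (cases "k = 0")
      case True
      then show ?thesis using alloc_value_nonneg[OF assms(1)] by simp
    next
      case k: False
      then have "n > 0" using False Suc by simp
      then have "(real k / real (Suc n))\<^sup>2 * alloc_value I y
          = (real k / real n)\<^sup>2 * ((real n / real (Suc n))\<^sup>2 * alloc_value I y)"
        by (simp add: power_divide)
      also have "\<dots> \<le> (real k / real n)\<^sup>2 * alloc_value I z"
        by (intro mult_left_mono z) auto
      finally show ?thesis using w(3) by linarith
    qed
    then show ?thesis using w Suc.hyps(2) by metis
  qed
qed

section \<open>Attainment, saturation and resizing of the offline optimum\<close>

lemma finite_feasible: "finite {x. feasible I x}"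
proof -
  have "{x. feasible I x} \<subseteq> {x. \<forall>i. (i \<in> products I \<longrightarrow> x i \<in> {..total_capacity I}) \<and> (i \<notin> products I \<longrightarrow> x i = 0)}"
    by (auto simp: feasible_def total_capacity_def intro!: order_trans[OF _ member_le_sum])
  moreover have "finite \<dots>"
    by (rule finite_set_of_finite_funs) auto
  ultimately show ?thesis by (rule finite_subset)
qed

lemma feasible_zero [simp]: "feasible I (\<lambda>_. 0)"
  by (simp add: feasible_def)

lemma alloc_size_le_total_capacity: "feasible I x \<Longrightarrow> alloc_size I x \<le> total_capacity I"
  by (auto simp: feasible_def alloc_size_def total_capacity_def intro: sum_mono)

lemma offline_opt_ge:
  assumes "feasible I x" "alloc_size I x \<le> l"
  shows "alloc_value I x \<le> offline_opt I l"
  unfolding offline_opt_def using assms finite_feasible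
  by (intro Max_ge) (auto intro: finite_subset[OF _ finite_feasible])

lemma offline_opt_attained:
  obtains x where "feasible I x" "alloc_size I x \<le> l" "offline_opt I l = alloc_value I x"
proof -
  have "offline_opt I l \<in> alloc_value I ` {x. feasible I x \<and> alloc_size I x \<le> l}"
    unfolding offline_opt_def
    by (intro Max_in) (auto intro!: exI[of _ "\<lambda>_. 0"] finite_imageI intro: finite_subset[OF _ finite_feasible] simp: alloc_size_def)
  then show ?thesis using that by auto
qed

lemma offline_opt_nonneg: "valid_instance I \<Longrightarrow> offline_opt I l \<ge> 0"
  by (metis offline_opt_attained alloc_value_nonneg)

lemma offline_opt_0 [simp]: "offline_opt I 0 = 0"
proof -
  obtain x where x: "feasible I x" "alloc_size I x \<le> 0" "offline_opt I 0 = alloc_value I x"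
    by (rule offline_opt_attained)
  then have "alloc_value I x = alloc_value I (\<lambda>_. 0)"
    by (intro alloc_value_cong) (simp add: alloc_size_def)
  with x show ?thesis by simp
qed

lemma offline_opt_saturated:
  assumes "total_capacity I \<le> l"
  shows "offline_opt I l = offline_opt I (total_capacity I)"
proof -
  have "{x. feasible I x \<and> alloc_size I x \<le> l} = {x. feasible I x \<and> alloc_size I x \<le> total_capacity I}"
    using assms alloc_size_le_total_capacity order_trans by blast
  then show ?thesis by (simp add: offline_opt_def)
qed

lemma offline_opt_le_total_capacity: "offline_opt I l \<le> offline_opt I (total_capacity I)"
  by (metis offline_opt_attained offline_opt_ge alloc_size_le_total_capacity)

text \<open>A maximizer for U(l) may have fewer than l units, whereas a repair target has exactly K.
  Padding closes this gap, and nonnegative rewards make it free.\<close>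

lemma extend_allocation:
  assumes "valid_instance I" "feasible I y" "alloc_size I y \<le> k" "k \<le> total_capacity I"
  shows "\<exists>z. feasible I z \<and> alloc_size I z = k \<and> alloc_value I y \<le> alloc_value I z"
  using assms(3,4)
proof (induction k rule: dec_induct)
  case base
  then show ?case using assms by blast
next
  case (step k)
  then obtain z where z: "feasible I z" "alloc_size I z = k" "alloc_value I y \<le> alloc_value I z"
    by auto
  have "\<exists>i\<in>products I. z i < capacity I i"
  proof (rule ccontr)
    assume "\<not> ?thesis"
    then have "total_capacity I \<le> alloc_size I z"
      unfolding total_capacity_def alloc_size_def by (intro sum_mono) (auto simp: not_less)
    with step z show False by simp
  qed
  then obtain i where i: "i \<in> products I" "z i < capacity I i" by blast
  have "alloc_value I z \<le> alloc_value I (z(i := Suc (z i)))"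
    by (intro alloc_value_mono assms) auto
  moreover have "feasible I (z(i := Suc (z i)))" using z i by (auto simp: feasible_def)
  moreover have "alloc_size I (z(i := Suc (z i))) = Suc k"
    using alloc_size_upd[OF i(1), of z "Suc (z i)"] z by simp
  ultimately show ?case using z(3) by (meson order_trans)
qed

text \<open>A maximizer for U(l) is padded if it has at most k units and cut down otherwise. Its
  size may be below l, which only increases the ratio when it is cut.\<close>

lemma offline_opt_scaling:
  assumes "valid_instance I" "concave_bonuses I" "k \<le> total_capacity I" "0 < l"
  shows "\<exists>z. feasible I z \<and> alloc_size I z = k \<and>
    alloc_value I z \<ge> min 1 ((real k / real l)\<^sup>2) * offline_opt I l"
proof -
  obtain y where y: "feasible I y" "alloc_size I y \<le> l" "offline_opt I l = alloc_value I y"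
    by (rule offline_opt_attained)
  have nn: "alloc_value I y \<ge> 0" by (simp add: alloc_value_nonneg assms)
  show ?thesis
  proof (cases "alloc_size I y \<le> k")
    case True
    then obtain z where z: "feasible I z" "alloc_size I z = k" "alloc_value I y \<le> alloc_value I z"
      using extend_allocation[OF assms(1) y(1)] assms by blast
    have "min 1 ((real k / real l)\<^sup>2) * alloc_value I y \<le> 1 * alloc_value I y"
      by (intro mult_right_mono nn) auto
    with z y show ?thesis by (metis mult_1 order_trans)
  next
    case False
    then obtain z where z: "feasible I z" "alloc_size I z = k"
        "alloc_value I z \<ge> (real k / real (alloc_size I y))\<^sup>2 * alloc_value I y"
      using suballocation[OF assms(1,2) y(1), of k] by auto
    have "min 1 ((real k / real l)\<^sup>2) \<le> (real k / real (alloc_size I y))\<^sup>2"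
      using y(2) False by (intro min.coboundedI2 power_mono divide_left_mono) auto
    then have "min 1 ((real k / real l)\<^sup>2) * alloc_value I y \<le> (real k / real (alloc_size I y))\<^sup>2 * alloc_value I y"
      by (rule mult_right_mono[OF _ nn])
    with z y show ?thesis by fastforce
  qed
qed

section \<open>The constants\<close>

lemma c_det_le:
  assumes "\<alpha> > 1" "\<theta> \<in> {1..1 + \<alpha>}"
  shows "c_det \<alpha> \<le> H_det \<alpha> \<theta>"
  using c_det_is_minimum[OF assms(1)] assms(2) by auto

lemma c_det_ge:
  assumes "\<alpha> > 1" "\<And>\<theta>. \<theta> \<in> {1..1 + \<alpha>} \<Longrightarrow> c \<le> H_det \<alpha> \<theta>"
  shows "c \<le> c_det \<alpha>"
  using c_det_is_minimum[OF assms(1)] assms(2) by auto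

lemma c_det_le_1:
  assumes "\<alpha> > 1"
  shows "c_det \<alpha> \<le> 1"
proof -
  have "c_det \<alpha> \<le> H_det \<alpha> 1" using assms by (intro c_det_le) auto
  also have "\<dots> \<le> 1" using assms by (simp add: H_det_def divide_simps)
  finally show ?thesis .
qed

text \<open>Replacing the min by its first argument can only increase \<open>H_det\<close>, so one
  \<theta> certifies an upper bound. Clearing denominators leaves a polynomial inequality.\<close>

lemma c_det_less:
  assumes "\<alpha> > 1" "\<theta> \<in> {1..1 + \<alpha>}"
    and "(\<theta> - 1)\<^sup>2 * (1 + \<alpha>)\<^sup>2 * \<theta>\<^sup>2 + \<alpha>\<^sup>2 * (\<alpha>\<^sup>2 - (\<theta> - 1)\<^sup>2) < v * (\<alpha>\<^sup>2 * (1 + \<alpha>)\<^sup>2 * \<theta>\<^sup>2)"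
  shows "c_det \<alpha> < v"
proof -
  have "c_det \<alpha> \<le> H_det \<alpha> \<theta>" by (rule c_det_le) (use assms in auto)
  also have "\<dots> \<le> (\<theta> - 1)\<^sup>2 * (1 / \<alpha>\<^sup>2) + (\<alpha>\<^sup>2 - (\<theta> - 1)\<^sup>2) / ((1 + \<alpha>)\<^sup>2 * \<theta>\<^sup>2)"
    unfolding H_det_def by (intro add_right_mono mult_left_mono) auto
  also have "\<dots> = ((\<theta> - 1)\<^sup>2 * (1 + \<alpha>)\<^sup>2 * \<theta>\<^sup>2 + \<alpha>\<^sup>2 * (\<alpha>\<^sup>2 - (\<theta> - 1)\<^sup>2)) / (\<alpha>\<^sup>2 * (1 + \<alpha>)\<^sup>2 * \<theta>\<^sup>2)"
  proof -
    have "\<alpha> \<noteq> 0" "1 + \<alpha> \<noteq> 0" "\<theta> \<noteq> 0" using assms(1,2) by auto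
    then show ?thesis by (simp add: add_divide_distrib)
  qed
  also have "\<dots> < v"
  proof -
    have "\<alpha>\<^sup>2 * (1 + \<alpha>)\<^sup>2 * \<theta>\<^sup>2 > 0" using assms(1,2) by simp
    then show ?thesis using assms(3) by (simp add: pos_divide_less_eq)
  qed
  finally show ?thesis .
qed

text \<open>Both arguments of the min have to be covered. Each polynomial inequality is demanded for
  all \<theta> \<ge> 1, which avoids a case split at \<theta> = \<alpha>.\<close>

lemma c_det_lower_bound:
  assumes "\<alpha> > 1"
    and "\<And>\<theta>. 1 \<le> \<theta> \<Longrightarrow> v * (\<alpha>\<^sup>2 * (1 + \<alpha>)\<^sup>2 * \<theta>\<^sup>2) \<le> (\<theta> - 1)\<^sup>2 * (1 + \<alpha>)\<^sup>2 * \<theta>\<^sup>2 + \<alpha>\<^sup>2 * (\<alpha>\<^sup>2 - (\<theta> - 1)\<^sup>2)"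
    and "\<And>\<theta>. 1 \<le> \<theta> \<Longrightarrow> v * ((1 + \<alpha>)\<^sup>2 * \<theta>\<^sup>2) \<le> (\<theta> - 1)\<^sup>2 * (1 + \<alpha>)\<^sup>2 + (\<alpha>\<^sup>2 - (\<theta> - 1)\<^sup>2)"
  shows "v \<le> c_det \<alpha>"
proof (rule c_det_ge[OF assms(1)])
  fix \<theta> assume \<theta>: "\<theta> \<in> {1..1 + \<alpha>}"
  have nz: "\<alpha> \<noteq> 0" "1 + \<alpha> \<noteq> 0" "\<theta> \<noteq> 0" and pos: "\<alpha>\<^sup>2 * (1 + \<alpha>)\<^sup>2 * \<theta>\<^sup>2 > 0" "(1 + \<alpha>)\<^sup>2 * \<theta>\<^sup>2 > 0"
    using assms(1) \<theta> by auto
  have "v \<le> ((\<theta> - 1)\<^sup>2 * (1 + \<alpha>)\<^sup>2 * \<theta>\<^sup>2 + \<alpha>\<^sup>2 * (\<alpha>\<^sup>2 - (\<theta> - 1)\<^sup>2)) / (\<alpha>\<^sup>2 * (1 + \<alpha>)\<^sup>2 * \<theta>\<^sup>2)"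
    using assms(2)[of \<theta>] \<theta> pos by (simp add: pos_le_divide_eq)
  also have "\<dots> = (\<theta> - 1)\<^sup>2 * (1 / \<alpha>\<^sup>2) + (\<alpha>\<^sup>2 - (\<theta> - 1)\<^sup>2) / ((1 + \<alpha>)\<^sup>2 * \<theta>\<^sup>2)"
    using nz by (simp add: add_divide_distrib)
  finally have 1: "v \<le> \<dots>" .
  have "v \<le> ((\<theta> - 1)\<^sup>2 * (1 + \<alpha>)\<^sup>2 + (\<alpha>\<^sup>2 - (\<theta> - 1)\<^sup>2)) / ((1 + \<alpha>)\<^sup>2 * \<theta>\<^sup>2)"
    using assms(3)[of \<theta>] \<theta> pos by (simp add: pos_le_divide_eq)
  also have "\<dots> = (\<theta> - 1)\<^sup>2 * (1 / \<theta>\<^sup>2) + (\<alpha>\<^sup>2 - (\<theta> - 1)\<^sup>2) / ((1 + \<alpha>)\<^sup>2 * \<theta>\<^sup>2)"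
    using nz by (simp add: add_divide_distrib)
  finally show "v \<le> H_det \<alpha> \<theta>" using 1 by (simp add: H_det_def min_def)
qed

section \<open>Numerical certificates for the maximum over \<alpha>\<close>

text \<open>The pair \<open>1.92317, 1.519975\<close> approximates the stationary point
  \<open>\<alpha> = 1.923170325..., \<theta> = 1.519974745...\<close> of the first branch of \<open>H_det\<close>,
  where the value is \<open>0.246756630874...\<close>; \<open>0.35\<close> approximates the slope of the
  minimizer \<open>\<theta>\<close> as a function of \<open>\<alpha>\<close>. The long decimals are the
  exact Taylor coefficients at that pair. For fixed \<open>\<theta>\<close> the stationary point is not a maximum
  in \<open>\<alpha>\<close>, so \<open>\<theta>\<close> has to vary with \<open>\<alpha>\<close>.\<close>

lemma c_det_less_away_from_optimum:
  assumes "\<alpha> > 1" "\<bar>\<alpha> - 1.9232\<bar> > 0.00005"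
  shows "c_det \<alpha> < 0.24675663087"
proof -
  define x where "x = \<alpha> - 1.92317"
  have \<alpha>: "\<alpha> = 1.92317 + x" by (simp add: x_def)
  have x: "x > - 0.92317" "x < - 0.00002 \<or> x > 0.00008" using assms by (auto simp: x_def abs_if split: if_splits)
  define \<theta> where "\<theta> = 1.519975 + 0.35 * x"
  define q where "q = 1.75940842581424646567289748727750575 + 2.6979030323839591310840680769 * x + 1.432864143931216320014855 * x\<^sup>2 + 0.292874684840016146 * x ^ 3 + 0.015221437281575 * x ^ 4"
  define w where "w = q * x\<^sup>2"
  \<comment> \<open>The expansion point is almost stationary with almost this value, so the constant
    and linear coefficients nearly vanish and the quadratic part decides. The bounds -0.00002 and
    0.00008 on x are the ends of the window as seen from 1.92317.\<close>
  have *: "0.24675663087 * (\<alpha>\<^sup>2 * (1 + \<alpha>)\<^sup>2 * \<theta>\<^sup>2) - ((\<theta> - 1)\<^sup>2 * (1 + \<alpha>)\<^sup>2 * \<theta>\<^sup>2 + \<alpha>\<^sup>2 * (\<alpha>\<^sup>2 - (\<theta> - 1)\<^sup>2))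
      = w - 0.00000124625868499886681536876874934725 * x - 0.0000000003695863559800097396197080480420625"
    unfolding \<alpha> \<theta>_def w_def q_def by algebra
  have "w - 0.00000124625868499886681536876874934725 * x - 0.0000000003695863559800097396197080480420625 > 0"
  \<comment> \<open>To the right of -0.1 the affine part of q alone is at least 1.4. Further left it
    becomes negative and needs help from the quadratic term.\<close>
  proof (cases "x \<ge> - 0.1")
    case True
    define r where "r = x\<^sup>2 * (1.432864143931216320014855 + 0.292874684840016146 * x + 0.015221437281575 * x\<^sup>2)"
    have "r \<ge> 0" unfolding r_def
      by (rule mult_nonneg_nonneg, simp, rule add_increasing2) (use True in auto)
    moreover have "q = 1.75940842581424646567289748727750575 + 2.6979030323839591310840680769 * x + r"
      unfolding q_def r_def by algebra
    ultimately have "q \<ge> 1.4" using True by simp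
    then have w: "w \<ge> 1.4 * x\<^sup>2" unfolding w_def by (intro mult_right_mono) auto
    show ?thesis
    proof (cases "x > 0")
      case True
      then have "0.00008 * x \<le> x\<^sup>2" using x unfolding power2_eq_square by (intro mult_right_mono) auto
      then show ?thesis using w x True by simp
    next
      case False
      then have "(- 0.00002) * x \<le> x\<^sup>2" using x unfolding power2_eq_square by (intro mult_right_mono_neg) auto
      then show ?thesis using w x False by simp
    qed
  next
    case False
    \<comment> \<open>The share 0.271 of the quadratic coefficient absorbs the cubic term, since
      0.2929 * 0.92317 is less than 0.271.\<close>
    define r where "r = x\<^sup>2 * (0.271 + 0.292874684840016146 * x + 0.015221437281575 * x\<^sup>2)"
    have "r \<ge> 0" unfolding r_def
      by (rule mult_nonneg_nonneg, simp, rule add_increasing2) (use x in auto)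
    moreover have "q = 1.75940842581424646567289748727750575 + 2.6979030323839591310840680769 * x + (1.432864143931216320014855 - 0.271) * x\<^sup>2 + r"
      unfolding q_def r_def by algebra
    \<comment> \<open>Tangent to the parabola at -0.924, just beyond the left end of the range. It
      turns the bound on q into an affine one with positive slope, so only that end has to be
      checked.\<close>
    moreover have "x\<^sup>2 \<ge> - 1.848 * x - 0.853776"
      using zero_le_power2[of "x + 0.924"] by (simp add: power2_sum power_divide)
    ultimately have "q \<ge> 0.2" using x(1) by simp
    then have "w \<ge> 0.2 * x\<^sup>2" unfolding w_def by (intro mult_right_mono) auto
    moreover have "(- 0.1) * x \<le> x\<^sup>2" using False unfolding power2_eq_square by (intro mult_right_mono_neg) auto
    ultimately show ?thesis using False by simp
  qed
  then have "(\<theta> - 1)\<^sup>2 * (1 + \<alpha>)\<^sup>2 * \<theta>\<^sup>2 + \<alpha>\<^sup>2 * (\<alpha>\<^sup>2 - (\<theta> - 1)\<^sup>2) < 0.24675663087 * (\<alpha>\<^sup>2 * (1 + \<alpha>)\<^sup>2 * \<theta>\<^sup>2)"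
    unfolding *[symmetric] by (simp only: diff_gt_0_iff_gt)
  moreover have "\<theta> \<in> {1..1 + \<alpha>}" using x(1) by (simp add: \<theta>_def \<alpha>)
  ultimately show ?thesis by (intro c_det_less assms(1))
qed

lemma c_det_near_optimum: "0.24675663087 \<le> c_det 1.92317"
proof (rule c_det_lower_bound)
  fix \<theta> :: real assume "\<theta> \<ge> 1"
  define y where "y = \<theta> - 1.519975"
  have \<theta>: "\<theta> = 1.519975 + y" and y: "y \<ge> - 0.52" using \<open>\<theta> \<ge> 1\<close> by (auto simp: y_def)
  have *: "((\<theta> - 1)\<^sup>2 * (1 + 1.92317)\<^sup>2 * \<theta>\<^sup>2 + 1.92317\<^sup>2 * (1.92317\<^sup>2 - (\<theta> - 1)\<^sup>2))
     - 0.24675663087 * (1.92317\<^sup>2 * (1 + 1.92317)\<^sup>2 * \<theta>\<^sup>2)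
     = y\<^sup>2 * (37.5686449095897699247285379565473 + 34.86243073122711 * y + 8.5449228489 * y\<^sup>2) + 0.000027596351540062489631461005964635 * y + 0.0000000003695863559800097396197080480420625"
    unfolding \<theta> by algebra
  \<comment> \<open>On y \<ge> -0.52 the bracket stays above 10, and the remaining quadratic has
    negative discriminant.\<close>
  have "y\<^sup>2 * (37.5686449095897699247285379565473 + 34.86243073122711 * y + 8.5449228489 * y\<^sup>2) \<ge> y\<^sup>2 * 10"
    using y by (intro mult_left_mono) (auto intro: add_increasing2)
  moreover have "10 * y\<^sup>2 + 0.000027596351540062489631461005964635 * y + 0.0000000003695863559800097396197080480420625 \<ge> 0"
    using zero_le_power2[of "y + 0.000027596351540062489631461005964635 / 20"] by (simp add: power2_sum power_divide)
  ultimately have "y\<^sup>2 * (37.5686449095897699247285379565473 + 34.86243073122711 * y + 8.5449228489 * y\<^sup>2) + 0.000027596351540062489631461005964635 * y + 0.0000000003695863559800097396197080480420625 \<ge> 0"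
    by simp
  then show "0.24675663087 * (1.92317\<^sup>2 * (1 + 1.92317)\<^sup>2 * \<theta>\<^sup>2)
    \<le> (\<theta> - 1)\<^sup>2 * (1 + 1.92317)\<^sup>2 * \<theta>\<^sup>2 + 1.92317\<^sup>2 * (1.92317\<^sup>2 - (\<theta> - 1)\<^sup>2)"
    unfolding *[symmetric] by (simp only: diff_ge_0_iff_ge)
  show "0.24675663087 * ((1 + 1.92317)\<^sup>2 * \<theta>\<^sup>2)
    \<le> (\<theta> - 1)\<^sup>2 * (1 + 1.92317)\<^sup>2 + (1.92317\<^sup>2 - (\<theta> - 1)\<^sup>2)"
  proof -
    have *: "(\<theta> - 1)\<^sup>2 * (1 + 1.92317)\<^sup>2 + (1.92317\<^sup>2 - (\<theta> - 1)\<^sup>2) - 0.24675663087 * ((1 + 1.92317)\<^sup>2 * \<theta>\<^sup>2)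
       = 5.436406475661353914457 * \<theta>\<^sup>2 - 15.0898456978 * \<theta> + 11.2435056978"
      by algebra
    \<comment> \<open>1.388 is the rounded vertex of this parabola.\<close>
    have "5.436406475661353914457 * \<theta>\<^sup>2 - 15.0898456978 * \<theta> + 11.2435056978 \<ge> 0"
      using zero_le_power2[of "\<theta> - 1.388"] \<open>\<theta> \<ge> 1\<close> by (simp add: power2_diff power_divide)
    then show ?thesis
      unfolding *[symmetric] by (simp only: diff_ge_0_iff_ge)
  qed
qed simp

lemma c_det_2_ge: "0.2466 \<le> c_det 2"
proof (rule c_det_lower_bound)
  fix \<theta> :: real assume "\<theta> \<ge> 1"
  \<comment> \<open>A round number near the minimizer for \<alpha> = 2, which is about
    1.5464.\<close>
  define y where "y = \<theta> - 1.55"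
  have \<theta>: "\<theta> = 1.55 + y" and y: "y \<ge> - 0.55" using \<open>\<theta> \<ge> 1\<close> by (auto simp: y_def)
  have *: "((\<theta> - 1)\<^sup>2 * (1 + 2)\<^sup>2 * \<theta>\<^sup>2 + 2\<^sup>2 * (2\<^sup>2 - (\<theta> - 1)\<^sup>2))
     - 0.2466 * (2\<^sup>2 * (1 + 2)\<^sup>2 * \<theta>\<^sup>2)
     = y\<^sup>2 * (42.1574 + 37.8 * y + 9 * y\<^sup>2) + 0.30394 * y + 0.00237225"
    unfolding \<theta> by algebra
  have "y\<^sup>2 * (42.1574 + 37.8 * y + 9 * y\<^sup>2) \<ge> y\<^sup>2 * 20"
    using y by (intro mult_left_mono) (auto intro: add_increasing2)
  moreover have "20 * y\<^sup>2 + 0.30394 * y + 0.00237225 \<ge> 0"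
    using zero_le_power2[of "y + 0.30394 / 40"] by (simp add: power2_sum power_divide)
  ultimately have "y\<^sup>2 * (42.1574 + 37.8 * y + 9 * y\<^sup>2) + 0.30394 * y + 0.00237225 \<ge> 0"
    by simp
  then show "0.2466 * (2\<^sup>2 * (1 + 2)\<^sup>2 * \<theta>\<^sup>2) \<le> (\<theta> - 1)\<^sup>2 * (1 + 2)\<^sup>2 * \<theta>\<^sup>2 + 2\<^sup>2 * (2\<^sup>2 - (\<theta> - 1)\<^sup>2)"
    unfolding *[symmetric] by (simp only: diff_ge_0_iff_ge)
  show "0.2466 * ((1 + 2)\<^sup>2 * \<theta>\<^sup>2) \<le> (\<theta> - 1)\<^sup>2 * (1 + 2)\<^sup>2 + (2\<^sup>2 - (\<theta> - 1)\<^sup>2)"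
    using zero_le_power2[of "\<theta> - 1.384"] \<open>\<theta> \<ge> 1\<close> by (simp add: power2_diff power_divide)
qed simp

lemma c_det_2_less: "c_det 2 < 0.2467"
  by (rule c_det_less[of _ "1.5464"]) (auto simp: power2_eq_square)

text \<open>For fixed \<theta> = 1.52 the numerator and the denominator both increase with \<alpha>.
  The window is so short that the numerator at its right end and the denominator at its left end
  suffice.\<close>

lemma c_det_less_near_optimum:
  assumes "\<bar>\<alpha> - 1.9232\<bar> \<le> 0.00005"
  shows "c_det \<alpha> < 0.2468"
proof -
  have \<alpha>: "\<alpha> \<ge> 1.92315" "\<alpha> \<le> 1.92325" using assms by (auto simp: abs_if split: if_splits)
  have "0.52\<^sup>2 * (1 + \<alpha>)\<^sup>2 * 1.52\<^sup>2 + \<alpha>\<^sup>2 * (\<alpha>\<^sup>2 - 0.52\<^sup>2) \<le> 0.52\<^sup>2 * (1 + 1.92325)\<^sup>2 * 1.52\<^sup>2 + 1.92325\<^sup>2 * (1.92325\<^sup>2 - 0.52\<^sup>2)"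
  proof -
    have "(1::real)\<^sup>2 \<le> \<alpha>\<^sup>2" using \<alpha> by (intro power_mono) auto
    then have "0.52\<^sup>2 \<le> \<alpha>\<^sup>2" by (simp add: power2_eq_square)
    then show ?thesis
      using \<alpha> by (intro add_mono mult_mono power_mono diff_right_mono) auto
  qed
  also have "\<dots> < 0.2468 * (1.92315\<^sup>2 * (1 + 1.92315)\<^sup>2 * 1.52\<^sup>2)"
    by (simp add: power2_eq_square)
  also have "\<dots> \<le> 0.2468 * (\<alpha>\<^sup>2 * (1 + \<alpha>)\<^sup>2 * 1.52\<^sup>2)"
    using \<alpha> by (intro mult_mono power_mono) auto
  finally show ?thesis
    using \<alpha> by (intro c_det_less[of _ "1.52"]) auto
qed

text \<open>An infimum of continuous functions is upper semicontinuous: the sets where \<open>c_det\<close> is at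
  least one of its values are closed and have the finite intersection property.\<close>

lemma c_det_attains_max_on_compact:
  assumes J: "compact J" "J \<noteq> {}" "J \<subseteq> {1<..}"
  shows "\<exists>\<alpha>\<in>J. \<forall>\<beta>\<in>J. c_det \<beta> \<le> c_det \<alpha>"
proof -
  \<comment> \<open>The substitution \<theta> = 1 + \<alpha> u makes the range of the minimization
    independent of \<alpha>, so a superlevel set becomes an intersection over one fixed index
    set.\<close>
  have c: "c \<le> c_det \<alpha> \<longleftrightarrow> (\<forall>u\<in>{0..1}. c \<le> H_det \<alpha> (1 + \<alpha> * u))" if "\<alpha> > 1" for \<alpha> c
  proof
    assume "c \<le> c_det \<alpha>"
    then show "\<forall>u\<in>{0..1}. c \<le> H_det \<alpha> (1 + \<alpha> * u)"
      using that by (auto intro!: order_trans[OF _ c_det_le])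
  next
    assume R: "\<forall>u\<in>{0..1}. c \<le> H_det \<alpha> (1 + \<alpha> * u)"
    show "c \<le> c_det \<alpha>"
    proof (rule c_det_ge[OF that])
      fix \<theta> assume "\<theta> \<in> {1..1 + \<alpha>}"
      then show "c \<le> H_det \<alpha> \<theta>"
        using bspec[OF R, of "(\<theta> - 1) / \<alpha>"] that by simp
    qed
  qed
  have cpt: "compact {\<alpha>\<in>J. c_det \<beta> \<le> c_det \<alpha>}" for \<beta>
  proof -
    have "{\<alpha>\<in>J. c_det \<beta> \<le> c_det \<alpha>} = (\<Inter>u\<in>{0..1}. {\<alpha>\<in>J. c_det \<beta> \<le> H_det \<alpha> (1 + \<alpha> * u)})"
    proof (rule set_eqI)
      fix \<alpha>
      show "\<alpha> \<in> {\<alpha>\<in>J. c_det \<beta> \<le> c_det \<alpha>} \<longleftrightarrow> \<alpha> \<in> (\<Inter>u\<in>{0..1}. {\<alpha>\<in>J. c_det \<beta> \<le> H_det \<alpha> (1 + \<alpha> * u)})"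
      proof (cases "\<alpha> \<in> J")
        case True
        then have "\<alpha> > 1" using J(3) by auto
        from c[OF this] True show ?thesis by simp
      next
        case False
        then show ?thesis by (auto intro!: bexI[of _ 0])
      qed
    qed
    moreover have "closed {\<alpha>\<in>J. c_det \<beta> \<le> H_det \<alpha> (1 + \<alpha> * u)}" if "u \<in> {0..1}" for u
    proof -
      have "continuous_on J (\<lambda>\<alpha>. H_det \<alpha> (1 + \<alpha> * u))"
        unfolding H_det_def using J(3) that
        by (intro continuous_intros) (auto simp: add_nonneg_eq_0_iff subset_iff dest!: bspec)
      then show ?thesis
        using J(1) by (intro continuous_on_closed_Collect_le) (auto intro: compact_imp_closed)
    qed
    ultimately show ?thesis
      using J(1) by (metis (no_types, lifting) closed_INT compact_Int_closed Int_absorb1 mem_Collect_eq subsetI)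
  qed
  have "J \<inter> \<Inter> ((\<lambda>\<beta>. {\<alpha>\<in>J. c_det \<beta> \<le> c_det \<alpha>}) ` J) \<noteq> {}"
  proof (rule compact_imp_fip_image[OF J(1)])
    show "closed {\<alpha>\<in>J. c_det \<beta> \<le> c_det \<alpha>}" for \<beta>
      by (rule compact_imp_closed[OF cpt])
  next
    fix F assume F: "finite F" "F \<subseteq> J"
    show "J \<inter> (\<Inter>\<beta>\<in>F. {\<alpha>\<in>J. c_det \<beta> \<le> c_det \<alpha>}) \<noteq> {}"
    proof (cases "F = {}")
      case False
      \<comment> \<open>A point of F with the largest value of \<open>c_det\<close> lies in all of
        the finitely many sets.\<close>
      then have "Max (c_det ` F) \<in> c_det ` F" using F(1) by (intro Max_in) auto
      then obtain b where b: "b \<in> F" "c_det b = Max (c_det ` F)" by auto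
      then have "b \<in> J \<inter> (\<Inter>\<beta>\<in>F. {\<alpha>\<in>J. c_det \<beta> \<le> c_det \<alpha>})"
        using F by auto
      then show ?thesis by blast
    qed (use J(2) in simp)
  qed
  then obtain \<alpha> where "\<alpha> \<in> J" "\<And>\<beta>. \<beta> \<in> J \<Longrightarrow> c_det \<beta> \<le> c_det \<alpha>"
    by blast
  then show ?thesis by blast
qed

lemma c_det_optimum:
  obtains \<alpha> where "\<alpha> > 1" "\<bar>\<alpha> - 1.9232\<bar> \<le> 0.00005" "0.2467 \<le> c_det \<alpha>" "c_det \<alpha> < 0.2468"
    "c_det \<alpha> = (SUP \<alpha>\<in>{1<..}. c_det \<alpha>)"
proof -
  let ?J = "{1.92315..1.92325} :: real set"
  have "\<exists>\<alpha>\<in>?J. \<forall>\<beta>\<in>?J. c_det \<beta> \<le> c_det \<alpha>"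
    by (rule c_det_attains_max_on_compact) auto
  then obtain \<alpha> where \<alpha>: "\<alpha> \<in> ?J" and max: "\<And>\<beta>. \<beta> \<in> ?J \<Longrightarrow> c_det \<beta> \<le> c_det \<alpha>" by blast
  have near: "0.24675663087 \<le> c_det \<alpha>"
    using c_det_near_optimum max[of "1.92317"] by simp
  have J: "\<beta> \<in> ?J \<longleftrightarrow> \<bar>\<beta> - 1.9232\<bar> \<le> 0.00005" for \<beta> :: real
    by (auto simp: abs_if split: if_splits)
  have "c_det \<beta> \<le> c_det \<alpha>" if "\<beta> > 1" for \<beta>
  proof (cases "\<beta> \<in> ?J")
    case False
    then have "c_det \<beta> < 0.24675663087"
      using that J by (intro c_det_less_away_from_optimum) (auto simp: not_le)
    with near show ?thesis by linarith
  qed (rule max)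
  then have "c_det \<alpha> = (SUP \<alpha>\<in>{1<..}. c_det \<alpha>)"
    using \<alpha> by (intro cSup_eq_maximum[symmetric]) auto
  moreover have "c_det \<alpha> < 0.2468" using \<alpha> J by (intro c_det_less_near_optimum) simp
  moreover have "0.2467 \<le> c_det \<alpha>" by (rule order_trans[OF _ near]) simp
  ultimately show ?thesis using that[of \<alpha>] \<alpha> J by auto
qed

section \<open>Analysis of Intermediate Target Repair\<close>

lemma total_reward_snoc:
  "total_reward I (ds @ [d]) = total_reward I ds + (case d of None \<Rightarrow> 0
     | Some i \<Rightarrow> base_reward I i + bonus I i (Suc (count_list ds (Some i))))"
proof -
  have "total_reward I (ds @ [d]) = (\<Sum>j<length ds. case ds ! j of
       None \<Rightarrow> 0
     | Some i \<Rightarrow> base_reward I i + bonus I i (count_list (take (Suc j) ds) (Some i)))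
     + (case d of None \<Rightarrow> 0
     | Some i \<Rightarrow> base_reward I i + bonus I i (Suc (count_list ds (Some i))))"
    unfolding total_reward_def
    by (auto simp: nth_append intro!: sum.cong split: option.splits)
  then show ?thesis by (simp add: total_reward_def)
qed

text \<open>The order of sales is irrelevant: appending a sale of i adds exactly the increment of
  \<open>product_reward\<close> at the current count of i.\<close>

lemma total_reward_eq_alloc_value:
  assumes "\<And>i. Some i \<in> set ds \<Longrightarrow> i \<in> products I"
  shows "total_reward I ds = alloc_value I (\<lambda>i. count_list ds (Some i))"
  using assms
proof (induction ds rule: rev_induct)
  case Nil
  then show ?case by (simp add: total_reward_def)
next
  case (snoc d ds)
  then have IH: "total_reward I ds = alloc_value I (\<lambda>i. count_list ds (Some i))" by simp
  show ?case
  proof (cases d)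
    case None
    then show ?thesis using IH by (simp add: total_reward_snoc)
  next
    case (Some i)
    let ?x = "\<lambda>i. count_list ds (Some i)"
    have i: "i \<in> products I" using snoc.prems Some by simp
    have "(\<lambda>j. count_list (ds @ [d]) (Some j)) = ?x(i := Suc (?x i))"
      by (auto simp: Some fun_eq_iff)
    then show ?thesis
      using IH Some by (simp add: total_reward_snoc alloc_value_upd[OF i] product_reward_Suc)
  qed
qed

lemma count_list_map_Some: "count_list (map Some xs) (Some i) = count_list xs i"
  by (induction xs) auto

lemma count_list_replicate_None: "count_list (replicate n None) (Some i) = 0"
  by (induction n) auto

lemma itr_reward_eq_alloc_value:
  assumes "set \<sigma> \<subseteq> products I"
  shows "itr_reward I \<sigma> l = alloc_value I (count_list (take l \<sigma>))"
  unfolding itr_reward_def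
  using assms set_take_subset[of l \<sigma>]
  by (subst total_reward_eq_alloc_value)
     (auto simp: count_list_map_Some count_list_replicate_None intro!: alloc_value_cong)

section \<open>Progress within one phase\<close>

lemma length_repair_order:
  assumes "repair_order d \<eta>" "finite A" "\<And>i. d i > 0 \<Longrightarrow> i \<in> A"
  shows "length \<eta> = sum d A"
proof -
  have "set \<eta> \<subseteq> A"
    using assms by (metis repair_order_def count_list_0_iff gr0I subsetI)
  then have "length \<eta> = (\<Sum>i\<in>A. count_list \<eta> i)"
    using assms(2) by (simp add: sum_count_set)
  then show ?thesis using assms(1) by (simp add: repair_order_def)
qed

lemma itr_phase_elim:
  assumes "valid_instance I" "itr_phase I \<alpha> \<sigma> \<tau>" "\<alpha> > 1"
    and int: "\<alpha> * real (length \<sigma>) \<in> \<int>" "(1 + \<alpha>) * real (length \<sigma>) \<in> \<int>"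
    and S: "length \<sigma> < total_capacity I"
  obtains K x \<eta> where "real K = min (\<alpha> * real (length \<sigma>)) (real (total_capacity I))"
    "feasible I x" "alloc_size I x = K"
    "\<forall>y. feasible I y \<and> alloc_size I y = K \<longrightarrow> alloc_value I y \<le> alloc_value I x"
    "prefix_robust I (count_list \<sigma>) (\<lambda>i. x i - count_list \<sigma> i) \<eta>"
    "real (length (\<sigma> @ \<tau>)) = min ((1 + \<alpha>) * real (length \<sigma>)) (real (total_capacity I))"
    "\<forall>h<length \<tau>. h < length \<eta> \<longrightarrow> \<tau> ! h = \<eta> ! h"
    "\<forall>h<length \<tau>. \<not> h < length \<eta> \<longrightarrow> \<tau> ! h \<in> products I"
proof -
  define M where "M = nat \<lfloor>min ((1 + \<alpha>) * real (length \<sigma>)) (real (total_capacity I))\<rfloor>"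
  define K where "K = nat \<lfloor>min (\<alpha> * real (length \<sigma>)) (real (total_capacity I))\<rfloor>"
  \<comment> \<open>The minimum is either the integer r or the natural number C, so the floor does
    not change it.\<close>
  have exact: "real (nat \<lfloor>min r (real C)\<rfloor>) = min r (real C)" if "r \<in> \<int>" "r \<ge> 0" for r C
    using that by (auto simp: min_def elim: Ints_cases)
  have K: "real K = min (\<alpha> * real (length \<sigma>)) (real (total_capacity I))"
    unfolding K_def using int \<open>\<alpha> > 1\<close> by (intro exact) auto
  have M: "real M = min ((1 + \<alpha>) * real (length \<sigma>)) (real (total_capacity I))"
    unfolding M_def using int \<open>\<alpha> > 1\<close> by (intro exact) auto
  obtain x \<eta> where x: "is_arg_max (alloc_value I) (\<lambda>y. feasible I y \<and> alloc_size I y = K) x"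
      and \<eta>: "prefix_robust I (count_list \<sigma>) (\<lambda>i. x i - count_list \<sigma> i) \<eta>"
      and \<tau>: "length \<tau> = M - length \<sigma>"
      "\<forall>h<length \<tau>. if h < length \<eta> then \<tau> ! h = \<eta> ! h
              else \<tau> ! h \<in> products I \<and> count_list (\<sigma> @ take h \<tau>) (\<tau> ! h) < capacity I (\<tau> ! h)"
    using assms(2) unfolding itr_phase_def Let_def K_def M_def by blast
  have "real (length \<sigma>) \<le> (1 + \<alpha>) * real (length \<sigma>)"
    using \<open>\<alpha> > 1\<close> by (simp add: algebra_simps)
  then have "length \<sigma> \<le> M" using M S by linarith
  then have "real (length (\<sigma> @ \<tau>)) = min ((1 + \<alpha>) * real (length \<sigma>)) (real (total_capacity I))"
    using \<tau>(1) M by simp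
  moreover have "\<forall>h<length \<tau>. h < length \<eta> \<longrightarrow> \<tau> ! h = \<eta> ! h"
    and "\<forall>h<length \<tau>. \<not> h < length \<eta> \<longrightarrow> \<tau> ! h \<in> products I"
    using \<tau>(2) by auto
  ultimately show ?thesis
    using that[OF K _ _ _ \<eta>] x by (auto simp: is_arg_max_linorder)
qed

text \<open>The squared progress \<open>(h / D)\<^sup>2\<close> of a robust repair is at least \<open>(h / N)\<^sup>2\<close>
  for every \<open>N \<ge> D\<close>, since repairing never decreases the value.\<close>

lemma prefix_robust_value:
  assumes "valid_instance I" "prefix_robust I s (\<lambda>i. x i - s i) \<eta>"
    and "0 < N" "real (length \<eta>) \<le> N" "real h \<le> N" "h \<le> length \<tau>"
    and agree: "\<forall>j<length \<tau>. j < length \<eta> \<longrightarrow> \<tau> ! j = \<eta> ! j"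
  shows "alloc_value I (\<lambda>i. s i + count_list (take h \<tau>) i)
    \<ge> (1 - (real h / N)\<^sup>2) * alloc_value I s + (real h / N)\<^sup>2 * alloc_value I x"
proof -
  \<comment> \<open>This is the pointwise maximum of s and x: units already sold beyond the target
    are kept, so it dominates both allocations.\<close>
  let ?y = "\<lambda>i. s i + (x i - s i)" and ?V = "alloc_value I"
  have le: "?V s \<le> ?V ?y" "?V x \<le> ?V ?y" by (intro alloc_value_mono assms; simp)+
  have "?V (\<lambda>i. s i + count_list (take h \<tau>) i) - ?V s \<ge> (real h / N)\<^sup>2 * (?V ?y - ?V s)"
  proof (cases "h < length \<eta>")
    case True
    have "take h \<tau> = take h \<eta>"
      using True \<open>h \<le> length \<tau>\<close> by (intro nth_equalityI) (auto simp: agree)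
    then have "?V (\<lambda>i. s i + count_list (take h \<tau>) i) - ?V s \<ge> (real h / real (length \<eta>))\<^sup>2 * (?V ?y - ?V s)"
      using assms(2) True unfolding prefix_robust_def by (metis less_imp_le)
    moreover have "(real h / N)\<^sup>2 \<le> (real h / real (length \<eta>))\<^sup>2"
      using True assms(3,4) by (intro power_mono divide_left_mono) (auto simp: zero_less_mult_iff)
    then have "(real h / N)\<^sup>2 * (?V ?y - ?V s) \<le> (real h / real (length \<eta>))\<^sup>2 * (?V ?y - ?V s)"
      using le by (intro mult_right_mono) auto
    ultimately show ?thesis by linarith
  next
    \<comment> \<open>The repair is complete, further sales do not lower the value, and the weight
      is at most 1. An empty repair order also falls under this case.\<close>
    case False
    have "take (length \<eta>) (take h \<tau>) = \<eta>"
      using False \<open>h \<le> length \<tau>\<close> by (intro nth_equalityI) (auto simp: agree)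
    then obtain \<rho> where "take h \<tau> = \<eta> @ \<rho>" by (metis append_take_drop_id)
    then have "?V ?y \<le> ?V (\<lambda>i. s i + count_list (take h \<tau>) i)"
      using assms(2) by (intro alloc_value_mono assms) (auto simp: prefix_robust_def repair_order_def)
    moreover have "(real h / N)\<^sup>2 \<le> 1" using assms(3,5) by (intro power_le_one) auto
    then have "(real h / N)\<^sup>2 * (?V ?y - ?V s) \<le> 1 * (?V ?y - ?V s)"
      using le by (intro mult_right_mono) auto
    ultimately show ?thesis by simp
  qed
  moreover have "(real h / N)\<^sup>2 * ?V x \<le> (real h / N)\<^sup>2 * ?V ?y" by (intro mult_left_mono le) auto
  ultimately show ?thesis by (simp add: algebra_simps)
qed

text \<open>Here v is the value at the phase start, w the target value and u the optimum. With
  \<theta> = l / S the two weighted bounds become the two summands of \<open>H_det\<close>, and l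
  \<le> (1 + \<alpha>) S keeps both weights nonnegative.\<close>

lemma H_det_combination:
  fixes S l \<alpha> v w u :: real
  assumes "S > 0" "l > 0" "\<alpha> > 1" "S \<le> l" "l \<le> (1 + \<alpha>) * S" "u \<ge> 0"
    and v: "v \<ge> (\<alpha> / (1 + \<alpha>))\<^sup>2 * (S / l)\<^sup>2 * u"
    and w: "w \<ge> min 1 ((\<alpha> * S / l)\<^sup>2) * u"
  shows "(1 - ((l - S) / (\<alpha> * S))\<^sup>2) * v + ((l - S) / (\<alpha> * S))\<^sup>2 * w \<ge> H_det \<alpha> (l / S) * u"
proof -
  define \<theta> where "\<theta> = l / S"
  have l: "l = \<theta> * S" and \<theta>: "\<theta> \<ge> 1" "\<theta> \<le> 1 + \<alpha>" using assms by (auto simp: \<theta>_def divide_simps)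
  have eqs: "(l - S) / (\<alpha> * S) = (\<theta> - 1) / \<alpha>" "S / l = 1 / \<theta>" "\<alpha> * S / l = \<alpha> / \<theta>"
    using assms(1,3) \<theta> by (simp_all add: l field_simps)
  have "((\<theta> - 1) / \<alpha>)\<^sup>2 \<le> 1" using \<theta> assms(3) by (intro power_le_one) auto
  then have 1: "(1 - ((\<theta> - 1) / \<alpha>)\<^sup>2) * v \<ge> (1 - ((\<theta> - 1) / \<alpha>)\<^sup>2) * ((\<alpha> / (1 + \<alpha>))\<^sup>2 * (1 / \<theta>)\<^sup>2 * u)"
    using v unfolding eqs by (intro mult_left_mono) auto
  have 2: "((\<theta> - 1) / \<alpha>)\<^sup>2 * w \<ge> ((\<theta> - 1) / \<alpha>)\<^sup>2 * (min 1 ((\<alpha> / \<theta>)\<^sup>2) * u)"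
    using w unfolding eqs by (intro mult_left_mono) auto
  have "(1 - ((\<theta> - 1) / \<alpha>)\<^sup>2) * ((\<alpha> / (1 + \<alpha>))\<^sup>2 * (1 / \<theta>)\<^sup>2) = (\<alpha>\<^sup>2 - (\<theta> - 1)\<^sup>2) / ((1 + \<alpha>)\<^sup>2 * \<theta>\<^sup>2)"
    using assms(3) \<theta> unfolding power_divide by (simp add: diff_divide_distrib left_diff_distrib)
  moreover have "((\<theta> - 1) / \<alpha>)\<^sup>2 * min 1 ((\<alpha> / \<theta>)\<^sup>2) = (\<theta> - 1)\<^sup>2 * min (1 / \<alpha>\<^sup>2) (1 / \<theta>\<^sup>2)"
  proof -
    have "(1 / \<alpha>\<^sup>2) * min 1 ((\<alpha> / \<theta>)\<^sup>2) = min (1 / \<alpha>\<^sup>2) (1 / \<theta>\<^sup>2)"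
      using assms(3) by (subst min_mult_distrib_left) (auto simp: power_divide)
    moreover have "((\<theta> - 1) / \<alpha>)\<^sup>2 * min 1 ((\<alpha> / \<theta>)\<^sup>2) = (\<theta> - 1)\<^sup>2 * ((1 / \<alpha>\<^sup>2) * min 1 ((\<alpha> / \<theta>)\<^sup>2))"
      by (simp add: power_divide)
    ultimately show ?thesis by (simp only:)
  qed
  ultimately have "H_det \<alpha> \<theta> * u = ((\<theta> - 1) / \<alpha>)\<^sup>2 * (min 1 ((\<alpha> / \<theta>)\<^sup>2) * u)
      + (1 - ((\<theta> - 1) / \<alpha>)\<^sup>2) * ((\<alpha> / (1 + \<alpha>))\<^sup>2 * (1 / \<theta>)\<^sup>2 * u)"
    unfolding H_det_def by (simp add: distrib_right mult.assoc[symmetric])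
  with 1 2 show ?thesis unfolding eqs \<theta>_def by (simp add: \<theta>_def[symmetric])
qed

text \<open>An allocation of size 1 is a single unit and cannot beat the best first sale. Scaling an
  optimum for l down to size 1 gives the factor.\<close>

lemma first_assignment_value:
  assumes "valid_instance I" "concave_bonuses I" "0 < l"
    and i: "is_arg_max (\<lambda>i. product_reward I i 1) (\<lambda>i. i \<in> products I \<and> capacity I i > 0) i"
  shows "alloc_value I (count_list [i]) \<ge> (1 / real l)\<^sup>2 * offline_opt I l"
proof -
  have i': "i \<in> products I" "capacity I i > 0"
    and max: "\<And>j. j \<in> products I \<Longrightarrow> capacity I j > 0 \<Longrightarrow> product_reward I j 1 \<le> product_reward I i 1"
    using i by (auto simp: is_arg_max_linorder)
  have "1 \<le> total_capacity I"
    using i' member_le_sum[of i "products I" "capacity I"] by (simp add: total_capacity_def)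
  then obtain z where z: "feasible I z" "alloc_size I z = 1"
      "alloc_value I z \<ge> min 1 ((real 1 / real l)\<^sup>2) * offline_opt I l"
    using offline_opt_scaling assms by blast
  have "alloc_value I z \<le> (\<Sum>j\<in>products I. real (z j) * product_reward I i 1)"
    unfolding alloc_value_def
  proof (rule sum_mono)
    fix j assume j: "j \<in> products I"
    have "z j \<le> 1" using z(2) j member_le_sum[of j "products I" z] by (simp add: alloc_size_def)
    then consider "z j = 0" | "z j = 1" by linarith
    then show "product_reward I j (z j) \<le> real (z j) * product_reward I i 1"
    proof cases
      case 2
      then have "capacity I j > 0" using z(1) j unfolding feasible_def by force
      with 2 max j show ?thesis by simp
    qed simp
  qed
  also have "\<dots> = real (alloc_size I z) * product_reward I i 1"
    by (simp add: alloc_size_def sum_distrib_right)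
  also have "\<dots> = alloc_value I ((\<lambda>_. 0)(i := 1))"
    using i'(1) z(2) by (simp add: alloc_value_upd)
  also have "(\<lambda>_. 0)(i := 1) = count_list [i]" by auto
  finally have "alloc_value I z \<le> alloc_value I (count_list [i])" .
  moreover have "(1 / real l)\<^sup>2 \<le> 1" using \<open>0 < l\<close> by (intro power_le_one) auto
  ultimately show ?thesis using z(3) by simp
qed

text \<open>Unless the capacity is exhausted, a phase ends having completed the repair towards the best
  allocation of size \<open>(\<alpha> / (1 + \<alpha>)) S\<close>, where \<open>S\<close> is the length of the new state;
  this and quadratic scaling give the third invariant.\<close>

lemma itr_state_invariants:
  assumes "valid_instance I" "concave_bonuses I" "\<alpha> > 1" "integral_phases I \<alpha>" "itr_state I \<alpha> \<sigma>"
  shows "0 < length \<sigma> \<and> set \<sigma> \<subseteq> products I \<and>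
    (length \<sigma> < total_capacity I \<longrightarrow> (\<forall>l\<ge>length \<sigma>.
      alloc_value I (count_list \<sigma>) \<ge> (\<alpha> / (1 + \<alpha>))\<^sup>2 * (real (length \<sigma>) / real l)\<^sup>2 * offline_opt I l)) \<and>
    (\<forall>l\<le>length \<sigma>. alloc_value I (count_list (take l \<sigma>)) \<ge> c_det \<alpha> * offline_opt I l)"
  using assms(5)
proof (induction rule: itr_state.induct)
  case (first i)
  note V = first_assignment_value[OF assms(1,2) _ first]
  note U = offline_opt_nonneg[OF assms(1)]
  have "(\<alpha> / (1 + \<alpha>))\<^sup>2 * (1 / real l)\<^sup>2 * offline_opt I l \<le> alloc_value I (count_list [i])" if "l \<ge> 1" for l
  proof -
    have "(\<alpha> / (1 + \<alpha>))\<^sup>2 \<le> 1" using \<open>\<alpha> > 1\<close> by (intro power_le_one) auto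
    then have "(\<alpha> / (1 + \<alpha>))\<^sup>2 * ((1 / real l)\<^sup>2 * offline_opt I l) \<le> 1 * ((1 / real l)\<^sup>2 * offline_opt I l)"
      by (intro mult_right_mono) (auto simp: U)
    also have "\<dots> \<le> alloc_value I (count_list [i])" using V[of l] that by simp
    finally show ?thesis by (simp only: mult.assoc)
  qed
  moreover have "c_det \<alpha> * offline_opt I l \<le> alloc_value I (count_list (take l [i]))" if "l \<le> 1" for l
  proof (cases "l = 0")
    case True
    then show ?thesis by (simp add: alloc_value_nonneg assms)
  next
    case False
    then have "l = 1" using that by simp
    moreover have "c_det \<alpha> * offline_opt I 1 \<le> 1 * offline_opt I 1"
      using c_det_le_1[OF assms(3)] by (intro mult_right_mono U)
    ultimately show ?thesis using V[of 1] by simp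
  qed
  moreover have "i \<in> products I" using first by (simp add: is_arg_max_def)
  ultimately show ?case by (simp del: count_list.simps)
next
  case (phase \<sigma> \<tau>)
  define S where "S = length \<sigma>"
  define s where "s = count_list \<sigma>"
  define C where "C = total_capacity I"
  have S: "0 < S" "S < C" using phase.IH phase.hyps(2) by (auto simp: S_def C_def)
  have int: "\<alpha> * real (length \<sigma>) \<in> \<int>" "(1 + \<alpha>) * real (length \<sigma>) \<in> \<int>"
    using assms(4) phase.hyps(1,2) by (auto simp: integral_phases_def)
  obtain K x \<eta> where K: "real K = min (\<alpha> * real S) (real C)"
    and x: "feasible I x" "alloc_size I x = K"
    and xmax: "\<forall>y. feasible I y \<and> alloc_size I y = K \<longrightarrow> alloc_value I y \<le> alloc_value I x"
    and \<eta>: "prefix_robust I s (\<lambda>i. x i - s i) \<eta>"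
    and M: "real (length (\<sigma> @ \<tau>)) = min ((1 + \<alpha>) * real S) (real C)"
    and \<tau>1: "\<forall>h<length \<tau>. h < length \<eta> \<longrightarrow> \<tau> ! h = \<eta> ! h"
    and \<tau>2: "\<forall>h<length \<tau>. \<not> h < length \<eta> \<longrightarrow> \<tau> ! h \<in> products I"
    by (rule itr_phase_elim[OF assms(1) phase.hyps(3) assms(3) int phase.hyps(2), folded S_def C_def s_def])
  have ro: "repair_order (\<lambda>i. x i - s i) \<eta>" using \<eta> by (simp add: prefix_robust_def)
  have supp: "i \<in> products I" if "x i - s i > 0" for i
    using that x(1) by (auto simp: feasible_def intro: ccontr)
  have "length \<eta> = (\<Sum>i\<in>products I. x i - s i)"
    using ro supp by (intro length_repair_order) auto
  also have "\<dots> \<le> K" unfolding x(2)[symmetric] alloc_size_def by (intro sum_mono) auto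
  finally have "real (length \<eta>) \<le> real K" by simp
  then have D: "real (length \<eta>) \<le> \<alpha> * real S" using K by linarith
  have N: "\<alpha> * real S > 0" using S assms(3) by simp
  have len: "real S + real (length \<tau>) = min ((1 + \<alpha>) * real S) (real C)"
    using M by (simp add: S_def)
  then have len_le: "real (length \<tau>) \<le> \<alpha> * real S" "S + length \<tau> \<le> C" by (simp_all add: algebra_simps)
  have "\<tau> ! h \<in> products I" if "h < length \<tau>" for h
  proof (cases "h < length \<eta>")
    case True
    then have "count_list \<eta> (\<eta> ! h) > 0" by (metis count_list_0_iff gr0I nth_mem)
    then show ?thesis using ro \<tau>1 that True supp by (simp add: repair_order_def)
  qed (use \<tau>2 that in auto)
  then have sub: "set (\<sigma> @ \<tau>) \<subseteq> products I" using phase.IH by (auto simp: in_set_conv_nth)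
  have gain: "alloc_value I (count_list (take (S + h) (\<sigma> @ \<tau>)))
      \<ge> (1 - (real h / (\<alpha> * real S))\<^sup>2) * alloc_value I s + (real h / (\<alpha> * real S))\<^sup>2 * alloc_value I x"
    if "h \<le> length \<tau>" for h
  proof -
    have "real h \<le> \<alpha> * real S" using that len_le by linarith
    moreover have "count_list (take (S + h) (\<sigma> @ \<tau>)) = (\<lambda>i. s i + count_list (take h \<tau>) i)"
      by (auto simp: S_def s_def)
    ultimately show ?thesis
      using prefix_robust_value[OF assms(1) \<eta> N D _ that \<tau>1] by simp
  qed
  have Vx: "alloc_value I x \<ge> min 1 ((real K / real l)\<^sup>2) * offline_opt I l" if l: "l > 0" for l
  proof -
    have "K \<le> total_capacity I" using K by (simp add: C_def)
    then obtain z where z: "feasible I z" "alloc_size I z = K"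
      "alloc_value I z \<ge> min 1 ((real K / real l)\<^sup>2) * offline_opt I l"
      using offline_opt_scaling[OF assms(1,2) _ l] by blast
    then have "alloc_value I z \<le> alloc_value I x" using xmax by blast
    with z(3) show ?thesis by linarith
  qed
  have "(\<alpha> / (1 + \<alpha>))\<^sup>2 * (real (length (\<sigma> @ \<tau>)) / real l)\<^sup>2 * offline_opt I l
      \<le> alloc_value I (count_list (\<sigma> @ \<tau>))"
    if less: "length (\<sigma> @ \<tau>) < total_capacity I" and l: "length (\<sigma> @ \<tau>) \<le> l" for l
  proof -
    have S': "real (length (\<sigma> @ \<tau>)) = (1 + \<alpha>) * real S" using less M unfolding C_def by linarith
    then have \<tau>: "real (length \<tau>) = \<alpha> * real S" by (simp add: S_def algebra_simps)
    have K': "real K = \<alpha> * real S" using K \<tau> len_le(2) by linarith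
    then have Kl: "real K \<le> real l" using l \<tau> by simp
    have "l > 0" using l S(1) unfolding S_def length_append by linarith
    \<comment> \<open>The new length is (1 + \<alpha>) S, so multiplying it by \<alpha> / (1 +
      \<alpha>) returns the target size K.\<close>
    have "(\<alpha> / (1 + \<alpha>))\<^sup>2 * (real (length (\<sigma> @ \<tau>)) / real l)\<^sup>2 = (real K / real l)\<^sup>2"
      unfolding S' K' using assms(3) by (simp add: power_divide power_mult_distrib)
    also have "\<dots> = min 1 ((real K / real l)\<^sup>2)"
      using Kl \<open>l > 0\<close> by (intro min_absorb2[symmetric] power_le_one) auto
    finally have "(\<alpha> / (1 + \<alpha>))\<^sup>2 * (real (length (\<sigma> @ \<tau>)) / real l)\<^sup>2 * offline_opt I l \<le> alloc_value I x"
      using Vx[OF \<open>l > 0\<close>] by simp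
    \<comment> \<open>At h = \<alpha> S the weight on the target is 1 and the value at the start
      drops out.\<close>
    also have "\<dots> \<le> alloc_value I (count_list (\<sigma> @ \<tau>))"
      using gain[of "length \<tau>"] \<tau> S assms(3) by (simp add: S_def)
    finally show ?thesis .
  qed
  moreover have "c_det \<alpha> * offline_opt I l \<le> alloc_value I (count_list (take l (\<sigma> @ \<tau>)))"
    if l: "l \<le> length (\<sigma> @ \<tau>)" for l
  proof (cases "l \<le> S")
    case True
    then show ?thesis using phase.IH by (simp add: S_def)
  next
    case False
    have lC: "l \<le> C" using l len_le by (simp add: S_def)
    have lS: "real l \<le> (1 + \<alpha>) * real S" using l M by linarith
    \<comment> \<open>If the capacity truncates the target, then K = C \<ge> l and the minimum on
      the right is 1.\<close>
    have "min 1 ((\<alpha> * real S / real l)\<^sup>2) \<le> min 1 ((real K / real l)\<^sup>2)"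
    proof (cases "\<alpha> * real S \<le> real C")
      case True
      then show ?thesis using K by simp
    next
      case False
      then have "1 \<le> real K / real l" using K lC \<open>\<not> l \<le> S\<close> by simp
      then have "1 \<le> (real K / real l)\<^sup>2" by (rule one_le_power)
      then show ?thesis by simp
    qed
    then have "min 1 ((\<alpha> * real S / real l)\<^sup>2) * offline_opt I l \<le> min 1 ((real K / real l)\<^sup>2) * offline_opt I l"
      by (intro mult_right_mono offline_opt_nonneg assms(1))
    also have "\<dots> \<le> alloc_value I x" using False by (intro Vx) simp
    finally have w: "min 1 ((\<alpha> * real S / real l)\<^sup>2) * offline_opt I l \<le> alloc_value I x" .
    \<comment> \<open>The previous state's bound is applied at the current l, which may lie far
      beyond S; hence its formulation for all larger counts.\<close>
    have v: "(\<alpha> / (1 + \<alpha>))\<^sup>2 * (real S / real l)\<^sup>2 * offline_opt I l \<le> alloc_value I s"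
      using phase.IH phase.hyps(2) False by (simp add: S_def s_def)
    have "c_det \<alpha> \<le> H_det \<alpha> (real l / real S)"
      using lS False S by (intro c_det_le assms(3)) (auto simp: field_simps)
    then have "c_det \<alpha> * offline_opt I l \<le> H_det \<alpha> (real l / real S) * offline_opt I l"
      by (intro mult_right_mono offline_opt_nonneg assms(1))
    also have "\<dots> \<le> (1 - ((real l - real S) / (\<alpha> * real S))\<^sup>2) * alloc_value I s
        + ((real l - real S) / (\<alpha> * real S))\<^sup>2 * alloc_value I x"
      using S False lS by (intro H_det_combination v w offline_opt_nonneg assms(1,3)) auto
    also have "\<dots> \<le> alloc_value I (count_list (take l (\<sigma> @ \<tau>)))"
      using gain[of "l - S"] False l by (simp add: of_nat_diff S_def)
    finally show ?thesis .
  qed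
  moreover have "0 < length (\<sigma> @ \<tau>)" using S by (simp add: S_def)
  ultimately show ?case using sub by blast
qed

text \<open>Past the total capacity both sides stay constant, so counts up to the length of the
  execution suffice. With zero capacity there is no first assignment, and both sides vanish.\<close>

lemma itr_reward_ge:
  assumes "valid_instance I" "concave_bonuses I" "\<alpha> > 1" "integral_phases I \<alpha>" "itr_execution I \<alpha> \<sigma>"
  shows "itr_reward I \<sigma> l \<ge> c_det \<alpha> * offline_opt I l"
proof (cases "total_capacity I = 0")
  case True
  then have "offline_opt I l = 0" using offline_opt_saturated[of I l] by simp
  moreover have "\<sigma> = []" using assms(5) True by (simp add: itr_execution_def)
  ultimately show ?thesis
    by (simp add: itr_reward_eq_alloc_value alloc_value_nonneg assms(1))
next
  case False
  then have \<sigma>: "itr_state I \<alpha> \<sigma>" "length \<sigma> = total_capacity I"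
    using assms(5) by (auto simp: itr_execution_def)
  note inv = itr_state_invariants[OF assms(1-4) \<sigma>(1)]
  have "offline_opt I l = offline_opt I (min l (length \<sigma>))"
    using offline_opt_saturated[of I l] \<sigma>(2) by (simp add: min_def)
  moreover have "take (min l (length \<sigma>)) \<sigma> = take l \<sigma>" by (simp add: min_def)
  ultimately show ?thesis
    using inv itr_reward_eq_alloc_value[of \<sigma> I l] by (metis min.cobounded2)
qed

section \<open>Online algorithms\<close>

lemma finite_set_pmf_arrivals: "finite (set_pmf (arrivals I))"
proof -
  have "set_pmf (arrivals I) \<subseteq> {a. \<forall>t. (t \<in> {1..horizon I} \<longrightarrow> a t \<in> UNIV) \<and> (t \<notin> {1..horizon I} \<longrightarrow> a t = False)}"
    unfolding arrivals_def using set_Pi_pmf_subset[of "{1..horizon I}" False "\<lambda>t. bernoulli_pmf (arrival_prob I t)"]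
    by auto
  moreover have "finite \<dots>" by (rule finite_set_of_finite_funs) auto
  ultimately show ?thesis by (rule finite_subset)
qed

lemma integrable_arrivals: "integrable (measure_pmf (arrivals I)) (f :: _ \<Rightarrow> real)"
  by (rule integrable_measure_pmf_finite[OF finite_set_pmf_arrivals])

text \<open>The argument is pathwise, for one fixed seed. A period without arrival appends
  \<open>None\<close>, so every sale is charged to the arrival of its own period.\<close>

lemma decisions_invariants:
  assumes "\<forall>as ds i. g as ds = Some i \<longrightarrow> i \<in> products I \<and> count_list ds (Some i) < capacity I i"
  shows "(\<forall>i. Some i \<in> set (decisions g a t) \<longrightarrow> i \<in> products I) \<and>
    (\<forall>i. count_list (decisions g a t) (Some i) \<le> capacity I i) \<and>
    (\<Sum>i\<in>products I. count_list (decisions g a t) (Some i)) \<le> card {u\<in>{1..t}. a u}"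
proof (induction t)
  case (Suc t)
  have "{u\<in>{1..Suc t}. a u} = (if a (Suc t) then insert (Suc t) {u\<in>{1..t}. a u} else {u\<in>{1..t}. a u})"
    by (auto simp: le_Suc_eq)
  then have card: "card {u\<in>{1..Suc t}. a u} = card {u\<in>{1..t}. a u} + (if a (Suc t) then 1 else 0)"
    by simp
  define d where "d = (if a (Suc t) then g (map a [1..<Suc (Suc t)]) (decisions g a t) else None)"
  have dec: "decisions g a (Suc t) = decisions g a t @ [d]" by (simp add: d_def)
  show ?case
  proof (cases d)
    case None
    then show ?thesis unfolding dec card using Suc by auto
  next
    case (Some i)
    then have a: "a (Suc t)" and "g (map a [1..<Suc (Suc t)]) (decisions g a t) = Some i"
      unfolding d_def by (metis option.distinct(1))+
    then have i: "i \<in> products I" "count_list (decisions g a t) (Some i) < capacity I i"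
      using assms by blast+
    have "(\<Sum>j\<in>products I. count_list (decisions g a t @ [d]) (Some j))
        = (\<Sum>j\<in>products I. count_list (decisions g a t) (Some j) + (if j = i then 1 else 0))"
      using Some by (intro sum.cong) auto
    also have "\<dots> = (\<Sum>j\<in>products I. count_list (decisions g a t) (Some j)) + 1"
      using i by (simp add: sum.distrib)
    finally show ?thesis unfolding dec card using Suc i a Some by auto
  qed
qed auto

lemma total_reward_decisions_le:
  assumes "\<forall>as ds i. g as ds = Some i \<longrightarrow> i \<in> products I \<and> count_list ds (Some i) < capacity I i"
  shows "total_reward I (decisions g a (horizon I)) \<le> offline_opt I (num_arrivals I a)"
proof -
  let ?ds = "decisions g a (horizon I)"
  note inv = decisions_invariants[OF assms, of a "horizon I"]
  have "total_reward I ?ds = alloc_value I (\<lambda>i. count_list ?ds (Some i))"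
    using inv by (intro total_reward_eq_alloc_value) blast
  also have "\<dots> \<le> offline_opt I (num_arrivals I a)"
  proof (rule offline_opt_ge)
    have "count_list ?ds (Some i) = 0" if "i \<notin> products I" for i
      using inv that by (metis count_list_0_iff)
    then show "feasible I (\<lambda>i. count_list ?ds (Some i))" using inv by (simp add: feasible_def)
    show "alloc_size I (\<lambda>i. count_list ?ds (Some i)) \<le> num_arrivals I a"
      using inv by (simp add: alloc_size_def num_arrivals_def)
  qed
  finally show ?thesis .
qed

text \<open>The pathwise bound is integrated over seeds and arrivals. The benchmark depends on the
  arrivals only, so Fubini removes the seed.\<close>

lemma online_value_le:
  assumes "valid_instance I" "online_algorithm I M g"
  shows "online_value I M g \<le> measure_pmf.expectation (arrivals I) (\<lambda>a. offline_opt I (num_arrivals I a))"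
proof -
  let ?P = "measure_pmf (arrivals I)" and ?U = "\<lambda>a. offline_opt I (num_arrivals I a)"
  interpret M: prob_space M using assms(2) by (simp add: online_algorithm_def)
  interpret pair_prob_space M ?P by standard
  have g: "i \<in> products I \<and> count_list ds (Some i) < capacity I i"
    if "w \<in> space M" "g w as ds = Some i" for w as ds i
    using assms(2) that unfolding online_algorithm_def by blast
  have int: "integrable (M \<Otimes>\<^sub>M ?P) (\<lambda>(w, a). ?U a)"
  proof (rule integrable_const_bound)
    show "AE z in M \<Otimes>\<^sub>M ?P. norm (case z of (w, a) \<Rightarrow> ?U a) \<le> offline_opt I (total_capacity I)"
      using assms(1) by (auto simp: offline_opt_nonneg offline_opt_le_total_capacity)
    show "(\<lambda>(w, a). ?U a) \<in> borel_measurable (M \<Otimes>\<^sub>M ?P)"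
      unfolding split_beta' by (rule measurable_compose[OF measurable_snd]) simp
  qed
  have "(\<integral>(w, a). ?U a \<partial>(M \<Otimes>\<^sub>M ?P)) = (\<integral>w. (\<integral>a. ?U a \<partial>?P) \<partial>M)"
    using integral_fst'[OF int] by simp
  also have "\<dots> = (\<integral>a. ?U a \<partial>?P)" by (simp add: M.prob_space)
  finally have eq: "(\<integral>(w, a). ?U a \<partial>(M \<Otimes>\<^sub>M ?P)) = (\<integral>a. ?U a \<partial>?P)" .
  show ?thesis
  proof (cases "integrable (M \<Otimes>\<^sub>M ?P) (\<lambda>(w, a). total_reward I (decisions (g w) a (horizon I)))")
    case True
    then have "online_value I M g \<le> (\<integral>(w, a). ?U a \<partial>(M \<Otimes>\<^sub>M ?P))"
      unfolding online_value_def using int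
      by (intro integral_mono) (auto simp: space_pair_measure intro!: total_reward_decisions_le dest: g)
    then show ?thesis unfolding eq .
  next
    \<comment> \<open>The Bochner integral of a non-integrable function is 0 by convention, and the
      benchmark is nonnegative.\<close>
    case False
    then have "online_value I M g = 0"
      by (simp add: online_value_def not_integrable_integral_eq)
    then show ?thesis by (simp add: offline_opt_nonneg assms(1))
  qed
qed

lemma opt_online_le:
  assumes "valid_instance I"
  shows "opt_online I \<le> measure_pmf.expectation (arrivals I) (\<lambda>a. offline_opt I (num_arrivals I a))"
  unfolding opt_online_def
proof (rule cSUP_least)
  \<comment> \<open>Rejecting everyone is an online algorithm, so the supremum is over a nonempty
    set.\<close>
  have "online_algorithm I (return borel 0) (\<lambda>_ _ _. None)"
    by (simp add: online_algorithm_def prob_space_return)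
  then show "{(M, g). online_algorithm I M g} \<noteq> {}" by blast
qed (auto intro: online_value_le assms)

lemma integral_phases_of_nat: "integral_phases I (real n)"
  by (simp add: integral_phases_def Ints_mult Ints_add)

theorem theorem4:
  fixes I :: alloc_instance
  assumes "valid_instance I" and "concave_bonuses I"
  shows "(\<forall>\<alpha>>1. integral_phases I \<alpha> \<longrightarrow>
            (\<forall>\<sigma>. itr_execution I \<alpha> \<sigma> \<longrightarrow>
               (\<forall>l. itr_reward I \<sigma> l \<ge> c_det \<alpha> * offline_opt I l))) \<and>
         0.2466 \<le> c_det 2 \<and> c_det 2 < 0.2467 \<and>
         0.2467 \<le> (SUP \<alpha>\<in>{1<..}. c_det \<alpha>) \<and> (SUP \<alpha>\<in>{1<..}. c_det \<alpha>) < 0.2468 \<and>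
         (\<exists>\<alpha>'>1. \<bar>\<alpha>' - 1.9232\<bar> \<le> 0.00005 \<and> c_det \<alpha>' = (SUP \<alpha>\<in>{1<..}. c_det \<alpha>)) \<and>
         (\<forall>\<sigma>. itr_execution I 2 \<sigma> \<longrightarrow>
            measure_pmf.expectation (arrivals I) (\<lambda>a. itr_reward I \<sigma> (num_arrivals I a))
              \<ge> 0.2466 * measure_pmf.expectation (arrivals I) (\<lambda>a. offline_opt I (num_arrivals I a))) \<and>
         0.2466 * measure_pmf.expectation (arrivals I) (\<lambda>a. offline_opt I (num_arrivals I a))
           \<ge> 0.2466 * opt_online I"
proof (intro conjI)
  show "\<forall>\<alpha>>1. integral_phases I \<alpha> \<longrightarrow> (\<forall>\<sigma>. itr_execution I \<alpha> \<sigma> \<longrightarrow>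
               (\<forall>l. itr_reward I \<sigma> l \<ge> c_det \<alpha> * offline_opt I l))"
    using itr_reward_ge[OF assms] by blast
  show "0.2466 \<le> c_det 2" by (rule c_det_2_ge)
  show "c_det 2 < 0.2467" by (rule c_det_2_less)
  obtain \<alpha> where \<alpha>: "\<alpha> > 1" "\<bar>\<alpha> - 1.9232\<bar> \<le> 0.00005" "0.2467 \<le> c_det \<alpha>" "c_det \<alpha> < 0.2468"
    "c_det \<alpha> = (SUP \<alpha>\<in>{1<..}. c_det \<alpha>)"
    by (rule c_det_optimum)
  show "0.2467 \<le> (SUP \<alpha>\<in>{1<..}. c_det \<alpha>)" using \<alpha>(3) unfolding \<alpha>(5) .
  show "(SUP \<alpha>\<in>{1<..}. c_det \<alpha>) < 0.2468" using \<alpha>(4) unfolding \<alpha>(5) .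
  show "\<exists>\<alpha>'>1. \<bar>\<alpha>' - 1.9232\<bar> \<le> 0.00005 \<and> c_det \<alpha>' = (SUP \<alpha>\<in>{1<..}. c_det \<alpha>)"
    using \<alpha>(1,2,5) by blast
  show "\<forall>\<sigma>. itr_execution I 2 \<sigma> \<longrightarrow>
      measure_pmf.expectation (arrivals I) (\<lambda>a. itr_reward I \<sigma> (num_arrivals I a))
        \<ge> 0.2466 * measure_pmf.expectation (arrivals I) (\<lambda>a. offline_opt I (num_arrivals I a))"
  proof (intro allI impI)
    fix \<sigma> assume \<sigma>: "itr_execution I 2 \<sigma>"
    have "0.2466 * offline_opt I l \<le> itr_reward I \<sigma> l" for l
    proof -
      have "0.2466 * offline_opt I l \<le> c_det 2 * offline_opt I l"
        by (intro mult_right_mono c_det_2_ge offline_opt_nonneg assms)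
      also have "\<dots> \<le> itr_reward I \<sigma> l"
        using integral_phases_of_nat[of I 2] \<sigma> by (intro itr_reward_ge assms) auto
      finally show ?thesis .
    qed
    then show "measure_pmf.expectation (arrivals I) (\<lambda>a. itr_reward I \<sigma> (num_arrivals I a))
        \<ge> 0.2466 * measure_pmf.expectation (arrivals I) (\<lambda>a. offline_opt I (num_arrivals I a))"
      unfolding integral_mult_right_zero[symmetric]
      by (intro integral_mono integrable_arrivals)
  qed
  show "0.2466 * measure_pmf.expectation (arrivals I) (\<lambda>a. offline_opt I (num_arrivals I a))
      \<ge> 0.2466 * opt_online I"
    by (intro mult_left_mono opt_online_le assms) simp
qed

end
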